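(* For all $A,B\in\mathbb{P}(2n)$, all $k=1,\dots,n$ and all $1\le i_1<\cdots<i_k\le n$, $$\sum_{j=1}^{k}d_{i_j}(A+B)\ge\sum_{j=1}^{k}d_{i_j}(A)+\sum_{j=1}^{k}d_{j}(B).$$ In particular, for every $j=1,\dots,n$, $d_j(A+B)\ge d_j(A)+d_1(B)$ and $d_j(A+I)\ge d_j(A)+1$, where $I$ is the $2n\times2n$ identity matrix.
   Context: Let $J=\begin{bmatrix}O & I_n\\ -I_n & O\end{bmatrix}$ ($2n\times 2n$). A real $2n\times 2n$ matrix $M$ is symplectic if $M^TJM=J$. $\mathbb{P}(2n)$ denotes the set of $2n\times 2n$ real symmetric positive definite matrices. By Williamson's theorem, for every $A\in\mathbb{P}(2n)$ there is a symplectic $M$ with $M^TAM=\begin{bmatrix}D&O\\O&D\end{bmatrix}$, $D=\mathrm{diag}(d_1(A),\dots,d_n(A))$, where $0<d_1(A)\le\dots\le d_n(A)$ are uniquely determined by $A$; they are the symplectic eigenvalues of $A$, always listed in increasing order. *)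

theory Defs
  imports Complex_Main "Jordan_Normal_Form.Matrix"
begin

definition symplectic_J :: "nat \<Rightarrow> real mat" where
  "symplectic_J n = four_block_mat (0\<^sub>m n n) (1\<^sub>m n) (- 1\<^sub>m n) (0\<^sub>m n n)"

definition symplectic :: "nat \<Rightarrow> real mat \<Rightarrow> bool" where
  "symplectic n M \<longleftrightarrow>
     M \<in> carrier_mat (2 * n) (2 * n) \<and> transpose_mat M * symplectic_J n * M = symplectic_J n"

definition pos_def_mats :: "nat \<Rightarrow> real mat set" where
  "pos_def_mats m =
     {A \<in> carrier_mat m m. transpose_mat A = A \<and>
        (\<forall>x \<in> carrier_vec m. x \<noteq> 0\<^sub>v m \<longrightarrow> x \<bullet> (A *\<^sub>v x) > 0)}"

definition williamson_form :: "nat \<Rightarrow> real mat \<Rightarrow> real list \<Rightarrow> bool" where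
  "williamson_form n A ds \<longleftrightarrow>
     length ds = n \<and> sorted ds \<and> (\<forall>d \<in> set ds. d > 0) \<and>
     (\<exists>M. symplectic n M \<and>
        transpose_mat M * A * M =
          four_block_mat (mat_diag n (\<lambda>i. ds ! i)) (0\<^sub>m n n)
                         (0\<^sub>m n n) (mat_diag n (\<lambda>i. ds ! i)))"

(* By Williamson's theorem the definite description is proper for A in pos_def_mats (2 * n). *)
definition symplectic_eigenvalues :: "nat \<Rightarrow> real mat \<Rightarrow> real list" where
  "symplectic_eigenvalues n A = (THE ds. williamson_form n A ds)"

(* d_j(A), numbered from 1 as usual in the literature: meaningful for 1 \<le> j \<le> n. *)
definition symplectic_eigenvalue :: "nat \<Rightarrow> real mat \<Rightarrow> nat \<Rightarrow> real" where
  "symplectic_eigenvalue n A j = symplectic_eigenvalues n A ! (j - 1)"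

end

theory Submission
  imports Defs "Jordan_Normal_Form.Determinant" "HOL-Computational_Algebra.Fundamental_Theorem_Algebra"
begin

text \<open>
  The \<open>d\<^sub>j(A)\<close> are the eigenvalues of positive type of the Hermitian pencil \<open>A - d (\<i> J)\<close>, and the
  inequality is the Wielandt-Lidskii argument in the indefinite inner product of \<open>\<i> J\<close>. On the span of
  the positive-type eigenvectors of \<open>A + B\<close> this inner product is the standard one of complex
  \<open>n\<close>-space. There one finds a \<open>k\<close>-dimensional subspace \<open>L\<close> with an orthonormal basis \<open>x\<^sub>j\<close> such that
  \<open>x\<^sub>j\<close> lies in the span of the first \<open>i\<^sub>j\<close> eigenvectors of \<open>A + B\<close>, and a second one \<open>y\<^sub>j\<close> such that
  \<open>y\<^sub>j\<close> has no component along the first \<open>i\<^sub>j - 1\<close> positive-type eigenvectors of \<open>A\<close>; a third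
  orthonormal basis \<open>z\<^sub>j\<close> of \<open>L\<close> has no components along the first \<open>j - 1\<close> ones of \<open>B\<close>. The trace of a form on \<open>L\<close>
  does not depend on the basis, so summing \<open>A + B\<close> over the \<open>x\<^sub>j\<close>, \<open>A\<close> over the \<open>y\<^sub>j\<close> and \<open>B\<close> over the \<open>z\<^sub>j\<close>
  gives the inequality. With \<open>B = 0\<close> and \<open>k = 1\<close> it also gives uniqueness in Williamson's theorem.
  Existence is obtained by splitting off eigenvectors of \<open>\<i> J A\<close> one at a time.
\<close>

section \<open>Orthonormal lists in complex coordinate space\<close>

definition cinner :: "nat \<Rightarrow> (nat \<Rightarrow> complex) \<Rightarrow> (nat \<Rightarrow> complex) \<Rightarrow> complex" where
  "cinner n x y = (\<Sum>i<n. cnj (x i) * y i)"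

definition lin_comb :: "complex \<Rightarrow> (nat \<Rightarrow> complex) \<Rightarrow> complex \<Rightarrow> (nat \<Rightarrow> complex) \<Rightarrow> nat \<Rightarrow> complex" where
  "lin_comb a x b y = (\<lambda>i. a * x i + b * y i)"

text \<open>For m = n this is the ambient space; the smaller m give the standard flag, which later
  stands for the spans of the first m eigenvectors of the sum.\<close>

definition coord_space :: "nat \<Rightarrow> (nat \<Rightarrow> complex) set" where
  "coord_space m = {x. \<forall>i\<ge>m. x i = 0}"

text \<open>Lists keep the basis vectors aligned with an index list through
  \<open>list_all2\<close>. Each pair is tested in one order only, since orthogonality is
  symmetric.\<close>

definition orthonormal :: "nat \<Rightarrow> (nat \<Rightarrow> complex) list \<Rightarrow> bool" where
  "orthonormal n xs \<longleftrightarrow>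
     sorted_wrt (\<lambda>x y. cinner n x y = 0) xs \<and> (\<forall>x\<in>set xs. cinner n x x = 1)"

text \<open>For orthonormal \<open>xs\<close> this is the squared norm of the projection of \<open>z\<close> onto the span of
  \<open>xs\<close>; hence two orthonormal lists span the same space iff their functions agree.\<close>

definition proj_norm :: "nat \<Rightarrow> (nat \<Rightarrow> complex) list \<Rightarrow> (nat \<Rightarrow> complex) \<Rightarrow> real" where
  "proj_norm n xs z = (\<Sum>x\<leftarrow>xs. (cmod (cinner n z x))\<^sup>2)"

lemma cinner_lin_comb_right:
  "cinner n z (lin_comb a x b y) = a * cinner n z x + b * cinner n z y"
  by (simp add: cinner_def lin_comb_def sum.distrib sum_distrib_left algebra_simps)

lemma cinner_commute: "cinner n y x = cnj (cinner n x y)"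
  by (simp add: cinner_def mult.commute)

lemma cinner_lin_comb_left:
  "cinner n (lin_comb a x b y) z = cnj a * cinner n x z + cnj b * cinner n y z"
  by (simp add: cinner_def lin_comb_def sum.distrib sum_distrib_left algebra_simps)

lemmas cinner_lin_comb = cinner_lin_comb_right cinner_lin_comb_left

lemma cinner_eq_0_commute: "cinner n x y = 0 \<longleftrightarrow> cinner n y x = 0"
  by (metis cinner_commute complex_cnj_zero)

lemma cinner_self: "cinner n x x = of_real (\<Sum>i<n. (cmod (x i))\<^sup>2)"
  unfolding cinner_def of_real_sum
  by (rule sum.cong) (simp_all only: complex_norm_square mult.commute)

lemma cinner_self_eq_0: "cinner n x x = 0 \<longleftrightarrow> (\<forall>i<n. x i = 0)"
proof -
  have "cinner n x x = 0 \<longleftrightarrow> (\<Sum>i<n. (cmod (x i))\<^sup>2) = 0"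
    unfolding cinner_self of_real_eq_0_iff ..
  also have "\<dots> \<longleftrightarrow> (\<forall>i\<in>{..<n}. (cmod (x i))\<^sup>2 = 0)"
    by (rule sum_nonneg_eq_0_iff) auto
  finally show ?thesis by auto
qed

lemma proj_norm_simps [simp]:
  "proj_norm n [] z = 0"
  "proj_norm n (x # xs) z = (cmod (cinner n z x))\<^sup>2 + proj_norm n xs z"
  "proj_norm n (xs @ ys) z = proj_norm n xs z + proj_norm n ys z"
  by (simp_all add: proj_norm_def)

lemma proj_norm_nonneg: "0 \<le> proj_norm n xs z"
  by (induction xs) auto

lemma proj_norm_eq_0_iff: "proj_norm n xs z = 0 \<longleftrightarrow> (\<forall>x\<in>set xs. cinner n z x = 0)"
  by (induction xs) (auto simp: add_nonneg_eq_0_iff proj_norm_nonneg)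

lemma orthonormal_Nil [simp]: "orthonormal n []"
  by (simp add: orthonormal_def)

lemma orthonormal_Cons [simp]:
  "orthonormal n (x # xs) \<longleftrightarrow>
     cinner n x x = 1 \<and> (\<forall>y\<in>set xs. cinner n x y = 0) \<and> orthonormal n xs"
  by (auto simp: orthonormal_def)

lemma orthonormal_snoc:
  "orthonormal n (xs @ [x]) \<longleftrightarrow>
     cinner n x x = 1 \<and> (\<forall>y\<in>set xs. cinner n x y = 0) \<and> orthonormal n xs"
  unfolding orthonormal_def sorted_wrt_append using cinner_eq_0_commute[of n x] by auto

lemma lin_comb_coord_space: "x \<in> coord_space m \<Longrightarrow> y \<in> coord_space m \<Longrightarrow> lin_comb a x b y \<in> coord_space m"
  by (simp add: coord_space_def lin_comb_def)

lemma cinner_coord_space: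
  assumes "x \<in> coord_space m" "m \<le> n"
  shows "cinner n z x = (\<Sum>i<m. cnj (z i) * x i)"
proof -
  have "(\<Sum>i<n. cnj (z i) * x i) = (\<Sum>i<m. cnj (z i) * x i)"
    by (rule sum.mono_neutral_right) (use assms in \<open>auto simp: coord_space_def\<close>)
  then show ?thesis by (simp add: cinner_def)
qed

lemma exists_unit_scaling:
  assumes "x \<in> coord_space m" "m \<le> n" "x i \<noteq> 0"
  obtains c :: real where "cinner n (lin_comb c x 0 x) (lin_comb c x 0 x) = 1"
proof -
  have "i < m" using assms(1,3) by (cases "i < m") (auto simp: coord_space_def)
  then have "i < n" using assms(2) by simp
  define s where "s = (\<Sum>i<n. (cmod (x i))\<^sup>2)"
  have s: "cinner n x x = of_real s" by (simp add: cinner_self s_def)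
  have "s \<noteq> 0" using cinner_self_eq_0[of n x] s \<open>i < n\<close> assms(3) by auto
  moreover have "s \<ge> 0" unfolding s_def by (intro sum_nonneg) auto
  ultimately have "s > 0" by simp
  define c where "c = 1 / sqrt s"
  have "c * c * s = 1" using \<open>s > 0\<close> by (simp add: c_def)
  have "cinner n (lin_comb c x 0 x) (lin_comb c x 0 x) = of_real (c * c * s)"
    by (simp add: cinner_lin_comb s)
  also have "\<dots> = 1" using \<open>c * c * s = 1\<close> by simp
  finally show ?thesis by (rule that)
qed

text \<open>Orthogonality to fewer than m vectors gives fewer than m linear equations in m unknowns;
  padding them with zero rows yields a singular square matrix.\<close>

lemma exists_unit_orthogonal:
  assumes "length zs < m" "m \<le> n"
  obtains x where "x \<in> coord_space m" "cinner n x x = 1" "\<forall>z\<in>set zs. cinner n z x = 0"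
proof -
  define A where "A = mat m m (\<lambda>(t, i). if t < length zs then cnj ((zs ! t) i) else 0)"
  have A: "A \<in> carrier_mat m m" by (simp add: A_def)
  \<comment> \<open>Row \<open>length zs\<close> is a padding row, and it exists because
    \<open>length zs < m\<close>.\<close>
  have eq: "A = mat\<^sub>r m m (\<lambda>t. if t = length zs then 0\<^sub>v m else row A t)"
    by (rule eq_matI) (auto simp: A_def)
  have "det A = 0"
    by (subst eq, rule det_row_0) (use assms A in auto)
  then obtain v where v: "v \<in> carrier_vec m" "v \<noteq> 0\<^sub>v m" "A *\<^sub>v v = 0\<^sub>v m"
    using det_0_iff_vec_prod_zero_field[OF A] by auto
  define x where "x = (\<lambda>i. if i < m then v $ i else 0)"
  have x: "x \<in> coord_space m" by (simp add: x_def coord_space_def)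
  have "\<exists>i<m. v $ i \<noteq> 0"
  proof (rule ccontr)
    assume "\<not> ?thesis"
    then have "v = 0\<^sub>v m" using v(1) by (intro eq_vecI) auto
    with v(2) show False by simp
  qed
  then obtain i where i: "i < m" "v $ i \<noteq> 0" by blast
  then have "x i \<noteq> 0" by (simp add: x_def)
  have orth: "cinner n z x = 0" if "z \<in> set zs" for z
  proof -
    obtain t where t: "t < length zs" "z = zs ! t" using \<open>z \<in> set zs\<close> by (metis in_set_conv_nth)
    have "cinner n z x = (\<Sum>i<m. cnj (z i) * x i)" by (rule cinner_coord_space[OF x assms(2)])
    also have "\<dots> = (A *\<^sub>v v) $ t"
      using t assms v(1) by (simp add: A_def scalar_prod_def x_def atLeast0LessThan)
    also have "\<dots> = 0" using v(3) t assms by simp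
    finally show ?thesis .
  qed
  obtain c :: real where "cinner n (lin_comb c x 0 x) (lin_comb c x 0 x) = 1"
    by (rule exists_unit_scaling[OF x assms(2) \<open>x i \<noteq> 0\<close>])
  with x orth show ?thesis
    by (intro that[of "lin_comb c x 0 x"]) (auto simp: lin_comb_coord_space cinner_lin_comb)
qed

text \<open>Unless u and w are parallel, Gram-Schmidt started at w and started at u gives two
  orthonormal bases w, v and u, y of one plane, so the squared coefficients of z have the same sum
  in both.\<close>

lemma exchange_unit_vectors:
  assumes "cinner n w w = 1" "cinner n u u = 1"
  shows "(\<forall>z. cmod (cinner n z w) = cmod (cinner n z u)) \<or>
    (\<exists>v y. (\<exists>a b. v = lin_comb a u b w) \<and> (\<exists>c d. y = lin_comb c w d u) \<and>
       cinner n v v = 1 \<and> cinner n y y = 1 \<and> cinner n v w = 0 \<and> cinner n y u = 0 \<and>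
       (\<forall>z. (cmod (cinner n z y))\<^sup>2 + (cmod (cinner n z u))\<^sup>2 =
            (cmod (cinner n z v))\<^sup>2 + (cmod (cinner n z w))\<^sup>2))"
proof -
  define g where "g = cinner n w u"
  have gu: "cinner n u w = cnj g" by (simp add: g_def cinner_commute[of n u w])
  \<comment> \<open>The part of u orthogonal to w. Its squared norm 1 - |g|^2 separates the two
    cases and normalizes both v and y.\<close>
  define e where "e = lin_comb 1 u (-g) w"
  have ee: "cinner n e e = 1 - g * cnj g"
    by (simp add: e_def cinner_lin_comb assms gu flip: g_def)
  have "g * cnj g = of_real ((cmod g)\<^sup>2)" by (simp add: complex_norm_square del: of_real_power)
  show ?thesis
  proof (cases "cmod g = 1")
    case True
    then have "cinner n e e = 0" using ee \<open>g * cnj g = _\<close> by simp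
    then have "\<forall>i<n. e i = 0" by (simp add: cinner_self_eq_0)
    then have "cinner n z e = 0" for z by (simp add: cinner_def)
    then have "cinner n z u = g * cinner n z w" for z
      by (simp add: e_def cinner_lin_comb)
    then show ?thesis using True by (simp add: norm_mult)
  next
    case False
    have "1 - (cmod g)\<^sup>2 \<ge> 0"
    proof -
      have "of_real (1 - (cmod g)\<^sup>2) = cinner n e e" using ee \<open>g * cnj g = _\<close> by simp
      then have "1 - (cmod g)\<^sup>2 = (\<Sum>i<n. (cmod (e i))\<^sup>2)"
        unfolding cinner_self of_real_eq_iff .
      then show ?thesis by (simp add: sum_nonneg)
    qed
    moreover have "(cmod g)\<^sup>2 \<noteq> 1" using False by (simp add: power2_eq_1_iff) (smt (verit) norm_ge_zero)
    ultimately have pos: "1 - (cmod g)\<^sup>2 > 0" by simp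
    define s where "s = sqrt (1 - (cmod g)\<^sup>2)"
    have s: "s > 0" "s * s = 1 - (cmod g)\<^sup>2" using pos by (auto simp: s_def)
    have ss: "complex_of_real s * complex_of_real s = 1 - g * cnj g"
      using s(2) \<open>g * cnj g = _\<close> by (metis of_real_1 of_real_diff of_real_mult)
    have s0: "complex_of_real s \<noteq> 0" using s by simp
    define r where "r = complex_of_real (1 / s)"
    have r: "cnj r = r" by (simp add: r_def)
    have rr: "r * r * (1 - g * cnj g) = 1" unfolding ss[symmetric] r_def using s0 by simp
    define v where "v = lin_comb r u (- (r * g)) w"
    define y where "y = lin_comb r w (- (r * cnj g)) u"
    have "cinner n v v = r * r * (1 - g * cnj g)" "cinner n y y = r * r * (1 - g * cnj g)"
      unfolding v_def y_def cinner_lin_comb assms gu g_def[symmetric]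
        complex_cnj_minus complex_cnj_mult complex_cnj_cnj r by (simp_all add: algebra_simps)
    then have "cinner n v v = 1" "cinner n y y = 1" by (simp_all only: rr)
    moreover have "cinner n v w = 0" "cinner n y u = 0"
      unfolding v_def y_def cinner_lin_comb assms gu g_def[symmetric]
        complex_cnj_minus complex_cnj_mult complex_cnj_cnj r by simp_all
    moreover have "(cmod (cinner n z y))\<^sup>2 + (cmod (cinner n z u))\<^sup>2 =
            (cmod (cinner n z v))\<^sup>2 + (cmod (cinner n z w))\<^sup>2" for z
    proof -
      define p where "p = cinner n z w"
      define q where "q = cinner n z u"
      have zy: "cinner n z y = r * (p - cnj g * q)" and zv: "cinner n z v = r * (q - g * p)"
        unfolding v_def y_def cinner_lin_comb p_def[symmetric] q_def[symmetric]
        by (simp_all add: algebra_simps)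
      have "r * (p - cnj g * q) * cnj (r * (p - cnj g * q)) + q * cnj q =
          r * r * (p * cnj p + q * cnj q * (g * cnj g)) -
          r * r * (g * p * cnj q + cnj g * cnj p * q) + r * r * (1 - g * cnj g) * (q * cnj q)"
        unfolding complex_cnj_mult complex_cnj_diff complex_cnj_cnj r rr by (simp add: algebra_simps)
      also have "\<dots> = r * r * (q * cnj q + p * cnj p * (g * cnj g)) -
          r * r * (g * p * cnj q + cnj g * cnj p * q) + r * r * (1 - g * cnj g) * (p * cnj p)"
        by (simp add: algebra_simps)
      also have "\<dots> = r * (q - g * p) * cnj (r * (q - g * p)) + p * cnj p"
        unfolding complex_cnj_mult complex_cnj_diff complex_cnj_cnj r rr by (simp add: algebra_simps)
      finally have "complex_of_real ((cmod (cinner n z y))\<^sup>2 + (cmod (cinner n z u))\<^sup>2) =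
         complex_of_real ((cmod (cinner n z v))\<^sup>2 + (cmod (cinner n z w))\<^sup>2)"
        unfolding of_real_add complex_norm_square zy zv p_def[symmetric] q_def[symmetric] .
      then show ?thesis unfolding of_real_eq_iff .
    qed
    moreover have "\<exists>a b. v = lin_comb a u b w" "\<exists>c d. y = lin_comb c w d u"
      unfolding v_def y_def by blast+
    ultimately show ?thesis by blast
  qed
qed

section \<open>The common span of two flags\<close>

lemma strictly_sorted_less_bound:
  assumes "sorted_wrt (<) (i # is)" "\<forall>j\<in>set (i # is). j < m"
  shows "i + length is < (m::nat)"
  using assms
proof (induction "is" arbitrary: i)
  case (Cons j js)
  then have "j + length js < m" by simp
  with Cons.prems show ?case by simp
qed simp

text \<open>Here \<open>W i\<close> has dimension at least \<open>m - i\<close>, expressed by the last assumption. In the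
  induction step the new vector is exchanged against the first old one unless the two are parallel.\<close>

lemma exchange_chain:
  assumes lin: "\<And>i a x b y. x \<in> W i \<Longrightarrow> y \<in> W i \<Longrightarrow> lin_comb a x b y \<in> W i"
    and dec: "\<And>i j. i \<le> j \<Longrightarrow> W j \<subseteq> W i"
    and ex: "\<And>i zs. i + length zs < m \<Longrightarrow>
               \<exists>u\<in>W i. cinner n u u = 1 \<and> (\<forall>z\<in>set zs. cinner n z u = 0)"
  shows "sorted_wrt (<) (is @ [k]) \<Longrightarrow> k < m \<Longrightarrow> list_all2 (\<lambda>i w. w \<in> W i) is ws \<Longrightarrow>
    orthonormal n ws \<Longrightarrow>
    \<exists>u ys. u \<in> W (hd (is @ [k])) \<and> orthonormal n (u # ws) \<and>
      list_all2 (\<lambda>i y. y \<in> W i) (is @ [k]) ys \<and> orthonormal n ys \<and>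
      (\<forall>z. proj_norm n ys z = proj_norm n (u # ws) z)"
proof (induction "is" arbitrary: ws)
  case Nil
  with ex[of k "[]"] obtain u where "u \<in> W k" "cinner n u u = 1" by auto
  with Nil show ?case by (intro exI[of _ u] exI[of _ "[u]"]) auto
next
  case (Cons i "is")
  from Cons.prems(3) obtain w ws' where ws: "ws = w # ws'" and w: "w \<in> W i"
    and ws': "list_all2 (\<lambda>i w. w \<in> W i) is ws'" by (auto simp: list_all2_Cons1)
  from Cons.prems(4) have ow: "cinner n w w = 1" "\<forall>x\<in>set ws'. cinner n w x = 0" "orthonormal n ws'"
    by (auto simp: ws)
  from Cons.IH[OF _ Cons.prems(2) ws' ow(3)] Cons.prems(1) obtain u ys where
    u: "u \<in> W (hd (is @ [k]))" and ou: "cinner n u u = 1" "\<forall>x\<in>set ws'. cinner n u x = 0" and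
    ys: "list_all2 (\<lambda>i y. y \<in> W i) (is @ [k]) ys" "orthonormal n ys" and
    F: "\<And>z. proj_norm n ys z = proj_norm n (u # ws') z"
    by auto
  have "i \<le> hd (is @ [k])" using Cons.prems(1) by (cases "is") auto
  with u dec have ui: "u \<in> W i" by blast
  from exchange_unit_vectors[OF ow(1) ou(1)] show ?case
  proof
    \<comment> \<open>Here u adds nothing to the span of w. The indices from i to k increase
      strictly below m, so W i has room for a unit vector v orthogonal to \<open>w # ws'\<close>,
      hence to u and to the span of \<open>ys\<close>. It is put in front of both lists.\<close>
    assume par: "\<forall>z. cmod (cinner n z w) = cmod (cinner n z u)"
    have "length ws' = length is" using ws' by (simp add: list_all2_lengthD)
    moreover have "i + length (is @ [k]) < m"
      by (rule strictly_sorted_less_bound) (use Cons.prems(1,2) in \<open>auto simp: sorted_wrt_append\<close>)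
    ultimately have "i + length (w # ws') < m" by simp
    from ex[OF this] obtain v where v: "v \<in> W i" "cinner n v v = 1"
      "\<forall>z\<in>set (w # ws'). cinner n z v = 0" by auto
    then have v': "\<forall>z\<in>set (w # ws'). cinner n v z = 0" using cinner_eq_0_commute by blast
    then have "cinner n v u = 0" using par by (metis list.set_intros(1) norm_eq_zero)
    with v' have "proj_norm n ys v = 0" unfolding F by (simp add: proj_norm_eq_0_iff)
    then have "\<forall>y\<in>set ys. cinner n v y = 0" by (simp add: proj_norm_eq_0_iff)
    with v v' ys par ow show ?thesis
      by (intro exI[of _ v] exI[of _ "v # ys"]) (auto simp: ws F)
  next
    assume "\<exists>v y. (\<exists>a b. v = lin_comb a u b w) \<and> (\<exists>c d. y = lin_comb c w d u) \<and>
       cinner n v v = 1 \<and> cinner n y y = 1 \<and> cinner n v w = 0 \<and> cinner n y u = 0 \<and>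
       (\<forall>z. (cmod (cinner n z y))\<^sup>2 + (cmod (cinner n z u))\<^sup>2 =
            (cmod (cinner n z v))\<^sup>2 + (cmod (cinner n z w))\<^sup>2)"
    then obtain v y a b c d where v: "v = lin_comb a u b w" and y: "y = lin_comb c w d u" and
      o: "cinner n v v = 1" "cinner n y y = 1" "cinner n v w = 0" "cinner n y u = 0" and
      G: "\<And>z. (cmod (cinner n z y))\<^sup>2 + (cmod (cinner n z u))\<^sup>2 =
            (cmod (cinner n z v))\<^sup>2 + (cmod (cinner n z w))\<^sup>2"
      by blast
    \<comment> \<open>v extends \<open>ws\<close>, while y goes in front of \<open>ys\<close>: being
      orthogonal to u and \<open>ws'\<close>, y is orthogonal to \<open>ys\<close>, which has the
      same span.\<close>
    have "\<forall>x\<in>set ws'. cinner n v x = 0" "\<forall>x\<in>set ws'. cinner n y x = 0"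
      using ow ou by (auto simp: v y cinner_lin_comb)
    moreover from this o have "proj_norm n ys y = 0" unfolding F by (simp add: proj_norm_eq_0_iff)
    then have "\<forall>x\<in>set ys. cinner n y x = 0" by (simp add: proj_norm_eq_0_iff)
    moreover have "proj_norm n (y # ys) z = proj_norm n (v # ws) z" for z
      using G[of z] by (simp add: F ws)
    moreover have "v \<in> W i" "y \<in> W i" using w ui lin by (auto simp: v y)
    ultimately show ?thesis using o ow ys
      by (intro exI[of _ v] exI[of _ "y # ys"]) (auto simp: ws)
  qed
qed

text \<open>The P l act as linear functionals and may be dependent, so this space has codimension at
  most i.\<close>

definition killed_by :: "nat \<Rightarrow> (nat \<Rightarrow> nat \<Rightarrow> complex) \<Rightarrow> nat \<Rightarrow> (nat \<Rightarrow> complex) set" where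
  "killed_by n P i = {x. \<forall>l<i. cinner n (P l) x = 0}"

lemma lin_comb_killed_by:
  "x \<in> killed_by n P i \<Longrightarrow> y \<in> killed_by n P i \<Longrightarrow> lin_comb a x b y \<in> killed_by n P i"
  by (simp add: killed_by_def cinner_lin_comb)

lemma cinner_unit:
  assumes "l < n" shows "cinner n (\<lambda>i. if i = l then 1 else 0) x = x l"
proof -
  have "cinner n (\<lambda>i. if i = l then 1 else 0) x = (\<Sum>i<n. if i = l then x i else 0)"
    unfolding cinner_def by (rule sum.cong) auto
  then show ?thesis using assms by simp
qed

text \<open>The subspace lemma behind Wielandt's minimax principle.\<close>

lemma common_span_of_flags:
  assumes "sorted_wrt (<) is" "\<forall>i\<in>set is. i < n"
  shows "\<exists>xs ys. orthonormal n xs \<and> orthonormal n ys \<and>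
    list_all2 (\<lambda>i x. x \<in> coord_space (Suc i)) is xs \<and>
    list_all2 (\<lambda>i y. y \<in> killed_by n P i) is ys \<and>
    (\<forall>x\<in>set ys. x \<in> coord_space n) \<and>
    (\<forall>z. proj_norm n xs z = proj_norm n ys z)"
  using assms
proof (induction "is" rule: rev_induct)
  case Nil
  show ?case by (intro exI[of _ "[]"]) auto
next
  case (snoc k "is")
  from snoc have si: "sorted_wrt (<) is" "\<forall>i\<in>set is. i < k" "k < n" by (auto simp: sorted_wrt_append)
  have "\<forall>i\<in>set is. i < n" using si by auto
  from snoc.IH[OF si(1) this] obtain xs ys where
    o: "orthonormal n xs" "orthonormal n ys" and
    xs: "list_all2 (\<lambda>i x. x \<in> coord_space (Suc i)) is xs" and
    ys: "list_all2 (\<lambda>i y. y \<in> killed_by n P i) is ys" "\<forall>y\<in>set ys. y \<in> coord_space n" and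
    F: "\<And>z. proj_norm n xs z = proj_norm n ys z"
    by blast
  \<comment> \<open>All earlier indices are below k, so the old \<open>xs\<close> lie in the space
    used for k; the \<open>ys\<close> then do too, having the same span.\<close>
  have xk: "x \<in> coord_space (Suc k)" if "x \<in> set xs" for x
  proof -
    obtain j where j: "j < length xs" "x = xs ! j" using \<open>x \<in> set xs\<close> by (metis in_set_conv_nth)
    with xs have "x \<in> coord_space (Suc (is ! j))" "j < length is" by (auto simp: list_all2_conv_all_nth)
    with si show ?thesis by (auto simp: coord_space_def dest!: nth_mem)
  qed
  have yk: "y \<in> coord_space (Suc k)" if "y \<in> set ys" for y
    unfolding coord_space_def
  proof safe
    fix l assume "Suc k \<le> l"
    show "y l = 0"
    proof (cases "l < n")
      case False
      then show ?thesis using ys(2) \<open>y \<in> set ys\<close> by (simp add: coord_space_def)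
    next
      case True
      \<comment> \<open>Comparing the two spans on the l-th unit vector reads off l-th coordinates:
        they vanish on \<open>xs\<close>, hence on \<open>ys\<close>.\<close>
      define e :: "nat \<Rightarrow> complex" where "e = (\<lambda>i. if i = l then 1 else 0)"
      have e: "cinner n e x = x l" for x unfolding e_def by (rule cinner_unit[OF True])
      have "proj_norm n xs e = 0"
        unfolding proj_norm_eq_0_iff e using xk \<open>Suc k \<le> l\<close> by (auto simp: coord_space_def)
      then have "proj_norm n ys e = 0" by (simp add: F)
      then show ?thesis using \<open>y \<in> set ys\<close> by (auto simp: proj_norm_eq_0_iff e)
    qed
  qed
  \<comment> \<open>In the (k + 1)-dimensional \<open>coord_space (Suc k)\<close>, i conditions
    leave dimension at least k + 1 - i, as \<open>exchange_chain\<close> requires.\<close>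
  define W where "W = (\<lambda>i. killed_by n P i \<inter> coord_space (Suc k))"
  have "\<exists>u ys'. u \<in> W (hd (is @ [k])) \<and> orthonormal n (u # ys) \<and>
      list_all2 (\<lambda>i y. y \<in> W i) (is @ [k]) ys' \<and> orthonormal n ys' \<and>
      (\<forall>z. proj_norm n ys' z = proj_norm n (u # ys) z)"
  proof (rule exchange_chain[where m = "Suc k"])
    show "lin_comb a x b y \<in> W i" if "x \<in> W i" "y \<in> W i" for i a x b y
      using that by (simp add: W_def lin_comb_killed_by lin_comb_coord_space)
    show "W j \<subseteq> W i" if "i \<le> j" for i j using that by (auto simp: W_def killed_by_def)
    show "\<exists>u\<in>W i. cinner n u u = 1 \<and> (\<forall>z\<in>set zs. cinner n z u = 0)"
      if "i + length zs < Suc k" for i zs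
    proof -
      have "length (map P [0..<i] @ zs) < Suc k" "Suc k \<le> n" using that si by simp_all
      then obtain x where "x \<in> coord_space (Suc k)" "cinner n x x = 1"
        "\<forall>z\<in>set (map P [0..<i] @ zs). cinner n z x = 0"
        by (rule exists_unit_orthogonal)
      then show ?thesis by (intro bexI[of _ x]) (auto simp: W_def killed_by_def)
    qed
    show "list_all2 (\<lambda>i w. w \<in> W i) is ys"
      using ys yk by (auto simp: W_def list_all2_conv_all_nth)
  qed (use snoc.prems o in auto)
  then obtain u ys' where u: "u \<in> coord_space (Suc k)" "orthonormal n (u # ys)" and
    ys': "list_all2 (\<lambda>i y. y \<in> W i) (is @ [k]) ys'" "orthonormal n ys'" and
    F': "\<And>z. proj_norm n ys' z = proj_norm n (u # ys) z" by (auto simp: W_def)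
  \<comment> \<open>The same u enlarges both spans: orthogonal to \<open>ys\<close>, it is
    orthogonal to \<open>xs\<close> as well.\<close>
  have "proj_norm n xs u = 0" unfolding F using u by (simp add: proj_norm_eq_0_iff)
  then have "orthonormal n (xs @ [u])"
    unfolding orthonormal_snoc using u o by (auto simp: proj_norm_eq_0_iff)
  moreover have "list_all2 (\<lambda>i x. x \<in> coord_space (Suc i)) (is @ [k]) (xs @ [u])"
    using xs u by (auto intro: list_all2_appendI)
  moreover have "list_all2 (\<lambda>i y. y \<in> killed_by n P i) (is @ [k]) ys'"
    by (rule list_all2_mono[OF ys'(1)]) (simp add: W_def)
  moreover have "\<forall>y\<in>set ys'. y \<in> coord_space n"
    using ys'(1) \<open>k < n\<close> by (auto simp: W_def coord_space_def list_all2_conv_all_nth in_set_conv_nth)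
  ultimately show ?case using ys' F F'
    by (intro exI[of _ "xs @ [u]"] exI[of _ ys']) auto
qed

text \<open>Inserts x in front of a basis occupying the levels s, s + 1, and so on. A rotation in
  the plane of x and the head w produces y, which stays at level s, and \<open>x'\<close>,
  orthogonal to P s, which is inserted into the tail at level s + 1.\<close>

lemma adapted_basis_snoc:
  assumes "x \<in> killed_by n P s" "x \<in> coord_space n" "orthonormal n (x # ws)"
    "list_all2 (\<lambda>i w. w \<in> killed_by n P i \<and> w \<in> coord_space n) [s..<s + length ws] ws"
  shows "\<exists>ys. list_all2 (\<lambda>i y. y \<in> killed_by n P i \<and> y \<in> coord_space n) [s..<Suc (s + length ws)] ys \<and>
    orthonormal n ys \<and> (\<forall>z. proj_norm n ys z = proj_norm n (x # ws) z)"
  using assms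
proof (induction ws arbitrary: s x)
  case Nil
  then show ?case by (intro exI[of _ "[x]"]) auto
next
  case (Cons w ws)
  have upt: "[s..<Suc (s + length (w # ws))] = s # [Suc s..<Suc (Suc s + length ws)]"
    "[s..<s + length (w # ws)] = s # [Suc s..<Suc s + length ws]"
    by (simp_all add: upt_conv_Cons del: upt_Suc)
  from Cons.prems(4) have w: "w \<in> killed_by n P s" "w \<in> coord_space n" and
    ws: "list_all2 (\<lambda>i w. w \<in> killed_by n P i \<and> w \<in> coord_space n) [Suc s..<Suc s + length ws] ws"
    unfolding upt by auto
  from Cons.prems(3) have o: "cinner n x x = 1" "cinner n w w = 1" "cinner n x w = 0" "cinner n w x = 0"
    "\<forall>y\<in>set ws. cinner n x y = 0" "\<forall>y\<in>set ws. cinner n w y = 0" "orthonormal n ws"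
    using cinner_eq_0_commute by auto
  define p where "p = cinner n (P s) x"
  define q where "q = cinner n (P s) w"
  \<comment> \<open>Unit coefficients making a x + b w orthogonal to P s: one linear equation in two
    unknowns.\<close>
  obtain a b where ab: "a * p + b * q = 0" "a * cnj a + b * cnj b = 1"
  proof (cases "p = 0 \<and> q = 0")
    case True
    then show ?thesis using that[of 1 0] by simp
  next
    case False
    define t where "t = sqrt ((cmod p)\<^sup>2 + (cmod q)\<^sup>2)"
    have "(cmod p)\<^sup>2 + (cmod q)\<^sup>2 > 0" using False
      by (cases "p = 0") (auto simp: add_pos_nonneg)
    then have "t \<noteq> 0" "t * t = (cmod p)\<^sup>2 + (cmod q)\<^sup>2" by (auto simp: t_def)
    then have t: "complex_of_real t \<noteq> 0" "complex_of_real t * complex_of_real t = p * cnj p + q * cnj q"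
      by (simp, simp only: of_real_mult[symmetric] of_real_add complex_norm_square)
    show ?thesis
    proof (rule that[of "q / t" "- p / t"])
      show "q / t * p + - p / t * q = 0" by simp
      have "q / t * cnj (q / t) + - p / t * cnj (- p / t) = (p * cnj p + q * cnj q) / (t * t)"
        by (simp add: add_divide_distrib)
      also have "\<dots> = 1" unfolding t(2)[symmetric] using t(1) by simp
      finally show "q / t * cnj (q / t) + - p / t * cnj (- p / t) = 1" .
    qed
  qed
  define x' where "x' = lin_comb a x b w"
  \<comment> \<open>Together with \<open>x'\<close> this applies the unitary matrix with rows (a, b)
    and (- cnj b, cnj a) to (x, w), so orthonormality and span are preserved.\<close>
  define y where "y = lin_comb (- cnj b) x (cnj a) w"
  have ab': "cnj a * a + cnj b * b = 1" using ab(2) by (simp add: mult.commute)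
  have o': "cinner n x' x' = 1" "cinner n y y = 1" "cinner n y x' = 0"
    "\<forall>v\<in>set ws. cinner n x' v = 0" "\<forall>v\<in>set ws. cinner n y v = 0"
    using o ab(2) ab' by (auto simp: x'_def y_def cinner_lin_comb algebra_simps)
  have "cinner n (P s) x' = 0" using ab(1) by (simp add: x'_def cinner_lin_comb p_def q_def)
  then have x': "x' \<in> killed_by n P (Suc s)" "x' \<in> coord_space n"
    using Cons.prems(1,2) w lin_comb_killed_by[OF Cons.prems(1) w(1)]
    by (auto simp: x'_def killed_by_def less_Suc_eq lin_comb_coord_space)
  have yy: "y \<in> killed_by n P s" "y \<in> coord_space n"
    using Cons.prems(1,2) w by (auto simp: y_def lin_comb_killed_by lin_comb_coord_space)
  have "orthonormal n (x' # ws)" using o o' by simp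
  from Cons.IH[OF x' this ws] obtain ys where
    ys: "list_all2 (\<lambda>i y. y \<in> killed_by n P i \<and> y \<in> coord_space n) [Suc s..<Suc (Suc s + length ws)] ys"
    "orthonormal n ys" and F: "\<And>z. proj_norm n ys z = proj_norm n (x' # ws) z" by blast
  have "proj_norm n ys y = 0" unfolding F using o' by (simp add: proj_norm_eq_0_iff)
  then have "orthonormal n (y # ys)" using o' ys by (simp add: proj_norm_eq_0_iff)
  moreover have "proj_norm n (y # ys) z = proj_norm n (x # w # ws) z" for z
  proof -
    define f where "f = cinner n z x"
    define g where "g = cinner n z w"
    have "(f * cnj f + g * cnj g) * (a * cnj a + b * cnj b) =
      (a * f + b * g) * cnj (a * f + b * g) + (- cnj b * f + cnj a * g) * cnj (- cnj b * f + cnj a * g)"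
      by (simp add: algebra_simps)
    then have "complex_of_real ((cmod (cinner n z y))\<^sup>2 + (cmod (cinner n z x'))\<^sup>2) =
        complex_of_real ((cmod f)\<^sup>2 + (cmod g)\<^sup>2)"
      unfolding of_real_add complex_norm_square x'_def y_def cinner_lin_comb ab(2)
        f_def[symmetric] g_def[symmetric] by (simp add: algebra_simps)
    then have "(cmod (cinner n z y))\<^sup>2 + (cmod (cinner n z x'))\<^sup>2 = (cmod f)\<^sup>2 + (cmod g)\<^sup>2"
      unfolding of_real_eq_iff .
    then show ?thesis by (simp add: F f_def g_def)
  qed
  ultimately show ?case unfolding upt using ys yy by (intro exI[of _ "y # ys"]) auto
qed

text \<open>Supplies the basis \<open>zs\<close> of the main argument. Each vector of
  \<open>xs\<close> is inserted at level 0, where it has no condition to meet.\<close>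

lemma exists_adapted_basis:
  assumes "orthonormal n xs" "\<forall>x\<in>set xs. x \<in> coord_space n"
  shows "\<exists>ys. list_all2 (\<lambda>i y. y \<in> killed_by n P i \<and> y \<in> coord_space n) [0..<length xs] ys \<and>
    orthonormal n ys \<and> (\<forall>z. proj_norm n ys z = proj_norm n xs z)"
  using assms
proof (induction xs)
  case Nil
  show ?case by (intro exI[of _ "[]"]) simp
next
  case (Cons x xs)
  then obtain ys where ys: "list_all2 (\<lambda>i y. y \<in> killed_by n P i \<and> y \<in> coord_space n) [0..<length xs] ys"
    "orthonormal n ys" and F: "\<And>z. proj_norm n ys z = proj_norm n xs z" by auto
  have len: "length ys = length xs" using ys(1) by (simp add: list_all2_lengthD[symmetric])
  have "proj_norm n ys x = 0" unfolding F using Cons.prems by (simp add: proj_norm_eq_0_iff)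
  then have "orthonormal n (x # ys)" using Cons.prems ys by (simp add: proj_norm_eq_0_iff)
  moreover have "list_all2 (\<lambda>i y. y \<in> killed_by n P i \<and> y \<in> coord_space n) [0..<0 + length ys] ys"
    using ys(1) len by simp
  moreover have "x \<in> killed_by n P 0" "x \<in> coord_space n" using Cons.prems by (auto simp: killed_by_def)
  ultimately show ?case using adapted_basis_snoc[of x n P 0 ys] F len by auto
qed

section \<open>Hermitian forms with symplectic coordinates\<close>

text \<open>The shape of a form in Williamson coordinates: \<open>P\<close> gives the coordinates of
  positive type, \<open>Q\<close> those of negative type, and both carry the weight a l.\<close>

definition weighted_form ::
  "nat \<Rightarrow> (nat \<Rightarrow> real) \<Rightarrow> (nat \<Rightarrow> nat \<Rightarrow> complex) \<Rightarrow> (nat \<Rightarrow> nat \<Rightarrow> complex) \<Rightarrow> (nat \<Rightarrow> complex) \<Rightarrow> real" where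
  "weighted_form n a P Q x =
     (\<Sum>l<n. a l * ((cmod (cinner n (P l) x))\<^sup>2 + (cmod (cinner n (Q l) x))\<^sup>2))"

text \<open>In these coordinates the form of \<open>\<i> J\<close> is the difference of the two sums
  of squares; the condition says that it restricts to the standard form on complex n-space.\<close>

definition krein_frame :: "nat \<Rightarrow> (nat \<Rightarrow> nat \<Rightarrow> complex) \<Rightarrow> (nat \<Rightarrow> nat \<Rightarrow> complex) \<Rightarrow> bool" where
  "krein_frame n P Q \<longleftrightarrow> (\<forall>x\<in>coord_space n.
     (\<Sum>l<n. (cmod (cinner n (P l) x))\<^sup>2 - (cmod (cinner n (Q l) x))\<^sup>2) = Re (cinner n x x))"

text \<open>Exchanging the sums expresses the trace by \<open>proj_norm\<close>, hence by the span
  alone.\<close>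

lemma sum_list_weighted_form:
  "(\<Sum>x\<leftarrow>xs. weighted_form n a P Q x) =
     (\<Sum>l<n. a l * (proj_norm n xs (P l) + proj_norm n xs (Q l)))"
  by (induction xs) (simp_all add: weighted_form_def sum.distrib[symmetric] algebra_simps)

text \<open>Compare termwise after multiplying the frame identity by a i: the P-terms with l < i
  vanish, those with l \<ge> i satisfy a i \<le> a l, and the Q-terms are nonpositive on the left
  and nonnegative on the right.\<close>

lemma weighted_form_ge:
  assumes "krein_frame n P Q" "mono_on {..<n} a" "\<And>l. l < n \<Longrightarrow> 0 \<le> a l" "i < n"
    and x: "x \<in> killed_by n P i" "x \<in> coord_space n" "cinner n x x = 1"
  shows "a i \<le> weighted_form n a P Q x"
proof -
  have "a i = a i * (\<Sum>l<n. (cmod (cinner n (P l) x))\<^sup>2 - (cmod (cinner n (Q l) x))\<^sup>2)"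
    using assms(1) x by (simp add: krein_frame_def)
  also have "\<dots> = (\<Sum>l<n. a i * ((cmod (cinner n (P l) x))\<^sup>2 - (cmod (cinner n (Q l) x))\<^sup>2))"
    by (rule sum_distrib_left)
  also have "\<dots> \<le> weighted_form n a P Q x"
    unfolding weighted_form_def
  proof (rule sum_mono)
    fix l assume l: "l \<in> {..<n}"
    have "a i * (cmod (cinner n (P l) x))\<^sup>2 \<le> a l * (cmod (cinner n (P l) x))\<^sup>2"
    proof (cases "l < i")
      case True
      then show ?thesis using x(1) by (simp add: killed_by_def)
    next
      case False
      then have "a i \<le> a l" using assms(2,4) l by (auto simp: mono_on_def)
      then show ?thesis by (simp add: mult_right_mono)
    qed
    moreover have "- (a i * (cmod (cinner n (Q l) x))\<^sup>2) \<le> a l * (cmod (cinner n (Q l) x))\<^sup>2"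
      using assms(3)[of l] assms(3)[of i] l assms(4)
      by (smt (verit) lessThan_iff mult_nonneg_nonneg zero_le_power2)
    ultimately show "a i * ((cmod (cinner n (P l) x))\<^sup>2 - (cmod (cinner n (Q l) x))\<^sup>2)
        \<le> a l * ((cmod (cinner n (P l) x))\<^sup>2 + (cmod (cinner n (Q l) x))\<^sup>2)"
      by (simp add: algebra_simps)
  qed
  finally show ?thesis .
qed

lemma sum_list_mono_list_all2:
  fixes f :: "'a \<Rightarrow> real"
  assumes "list_all2 R is xs" "\<And>i x. i \<in> set is \<Longrightarrow> x \<in> set xs \<Longrightarrow> R i x \<Longrightarrow> f i \<le> g x"
  shows "(\<Sum>i\<leftarrow>is. f i) \<le> (\<Sum>x\<leftarrow>xs. g x)"
  using assms by (induction rule: list_all2_induct) (auto intro: add_mono)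

lemma orthonormal_unit: "orthonormal n xs \<Longrightarrow> x \<in> set xs \<Longrightarrow> cinner n x x = 1"
  by (simp add: orthonormal_def)

text \<open>The Wielandt-Lidskii argument in coordinates where the sum of the two forms is diagonal
  with entries c.\<close>

lemma lidskii_forms:
  assumes frames: "krein_frame n P Q" "krein_frame n P' Q'"
    and a: "mono_on {..<n} a" "\<And>l. l < n \<Longrightarrow> 0 \<le> a l"
    and b: "mono_on {..<n} b" "\<And>l. l < n \<Longrightarrow> 0 \<le> b l"
    and c: "mono_on {..<n} c"
    and sum: "\<And>x. x \<in> coord_space n \<Longrightarrow>
      weighted_form n a P Q x + weighted_form n b P' Q' x = (\<Sum>l<n. c l * (cmod (x l))\<^sup>2)"
    and "is": "sorted_wrt (<) is" "\<forall>i\<in>set is. i < n"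
  shows "(\<Sum>i\<leftarrow>is. a i) + (\<Sum>j<length is. b j) \<le> (\<Sum>i\<leftarrow>is. c i)"
proof -
  from common_span_of_flags[OF "is", of P] obtain xs ys where
    o: "orthonormal n xs" "orthonormal n ys" and
    xs: "list_all2 (\<lambda>i x. x \<in> coord_space (Suc i)) is xs" and
    ys: "list_all2 (\<lambda>i y. y \<in> killed_by n P i) is ys" "\<forall>x\<in>set ys. x \<in> coord_space n" and
    F: "\<And>z. proj_norm n xs z = proj_norm n ys z" by blast
  have len: "length xs = length is" using xs by (simp add: list_all2_lengthD)
  have xn: "\<forall>x\<in>set xs. x \<in> coord_space n"
    using xs "is"(2)
    by (induction rule: list_all2_induct) (auto simp: coord_space_def)
  from exists_adapted_basis[OF o(1) xn, of P'] obtain zs where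
    zs: "list_all2 (\<lambda>i y. y \<in> killed_by n P' i \<and> y \<in> coord_space n) [0..<length xs] zs"
    "orthonormal n zs" and G: "\<And>z. proj_norm n zs z = proj_norm n xs z" by blast
  \<comment> \<open>Keeps the indices of b, which run below \<open>length is\<close>, where b is
    monotone and nonnegative.\<close>
  have "length is \<le> n"
  proof (cases "is")
    case (Cons i js)
    then show ?thesis using strictly_sorted_less_bound[of i js n] "is" by simp
  qed simp
  have "(\<Sum>i\<leftarrow>is. a i) \<le> (\<Sum>y\<leftarrow>ys. weighted_form n a P Q y)"
    using ys "is"(2) orthonormal_unit[OF o(2)]
    by (intro sum_list_mono_list_all2[OF ys(1)] weighted_form_ge[OF frames(1) a]) auto
  moreover have "(\<Sum>i\<leftarrow>[0..<length xs]. b i) \<le> (\<Sum>z\<leftarrow>zs. weighted_form n b P' Q' z)"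
    using \<open>length is \<le> n\<close> len orthonormal_unit[OF zs(2)]
    by (intro sum_list_mono_list_all2[OF zs(1)] weighted_form_ge[OF frames(2) b]) auto
  \<comment> \<open>Invariance of the trace: \<open>xs\<close>, \<open>ys\<close> and
    \<open>zs\<close> span the same space, so each form is summed over its own basis.\<close>
  moreover have "(\<Sum>x\<leftarrow>xs. weighted_form n a P Q x + weighted_form n b P' Q' x) =
      (\<Sum>y\<leftarrow>ys. weighted_form n a P Q y) + (\<Sum>z\<leftarrow>zs. weighted_form n b P' Q' z)"
    by (simp add: sum_list_addf sum_list_weighted_form F G)
  \<comment> \<open>Negated because \<open>sum_list_mono_list_all2\<close> has the index sum on the
    smaller side.\<close>
  moreover have "- (\<Sum>i\<leftarrow>is. c i) \<le> - (\<Sum>x\<leftarrow>xs. weighted_form n a P Q x + weighted_form n b P' Q' x)"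
    unfolding uminus_sum_list_map o_def
  proof (rule sum_list_mono_list_all2[OF xs])
    fix i x assume "i \<in> set is" and x: "x \<in> set xs" "x \<in> coord_space (Suc i)"
    then have "i < n" using "is" by simp
    have "(\<Sum>l<n. c l * (cmod (x l))\<^sup>2) \<le> (\<Sum>l<n. c i * (cmod (x l))\<^sup>2)"
    proof (rule sum_mono)
      fix l assume "l \<in> {..<n}"
      show "c l * (cmod (x l))\<^sup>2 \<le> c i * (cmod (x l))\<^sup>2"
      proof (cases "l \<le> i")
        case True
        then have "c l \<le> c i" using c \<open>i < n\<close> by (auto simp: mono_on_def)
        then show ?thesis by (simp add: mult_right_mono)
      qed (use x in \<open>simp add: coord_space_def\<close>)
    qed
    also have "\<dots> = c i * Re (cinner n x x)" by (simp add: cinner_self sum_distrib_left)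
    also have "\<dots> = c i" using orthonormal_unit[OF o(1) x(1)] by simp
    finally show "- c i \<le> - (weighted_form n a P Q x + weighted_form n b P' Q' x)"
      using sum xn x by simp
  qed
  ultimately show ?thesis using len
    by (simp add: interv_sum_list_conv_sum_set_nat atLeast0LessThan)
qed

section \<open>Real block matrices and the complex forms they induce\<close>

definition double_diag :: "nat \<Rightarrow> (nat \<Rightarrow> real) \<Rightarrow> real mat" where
  "double_diag n a = four_block_mat (mat_diag n a) (0\<^sub>m n n) (0\<^sub>m n n) (mat_diag n a)"

lemma double_diag_carrier [simp]: "double_diag n a \<in> carrier_mat (2 * n) (2 * n)"
  by (simp add: double_diag_def mult_2)

lemma symplectic_J_carrier [simp]: "symplectic_J n \<in> carrier_mat (2 * n) (2 * n)"
  by (simp add: symplectic_J_def mult_2)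

lemma double_diag_index:
  "r < 2 * n \<Longrightarrow> s < 2 * n \<Longrightarrow>
    double_diag n a $$ (r, s) = (if r = s then (if r < n then a r else a (r - n)) else 0)"
  by (auto simp: double_diag_def mat_diag_def)

lemma symplectic_J_index:
  "r < 2 * n \<Longrightarrow> s < 2 * n \<Longrightarrow>
    symplectic_J n $$ (r, s) = (if s = r + n then 1 else if r = s + n then - 1 else 0)"
  by (auto simp: symplectic_J_def)

lemma sum_lessThan_double: "(\<Sum>r<2 * n. f r) = (\<Sum>l<n. f l + f (n + l))"
  for f :: "nat \<Rightarrow> 'a :: comm_monoid_add"
proof -
  have "(\<Sum>r<n + m. f r) = (\<Sum>r<n. f r) + (\<Sum>r<m. f (n + r))" for m
    by (induction m) (simp_all add: add.assoc)
  then show ?thesis by (simp add: mult_2 sum.distrib)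
qed

lemma double_diag_mult_vec:
  assumes "v \<in> carrier_vec (2 * n)" "r < 2 * n"
  shows "(double_diag n a *\<^sub>v v) $ r = (if r < n then a r else a (r - n)) * v $ r"
proof -
  have "(double_diag n a *\<^sub>v v) $ r = (\<Sum>s<2 * n. double_diag n a $$ (r, s) * v $ s)"
    using assms carrier_matD[OF double_diag_carrier[of n a]]
    by (simp add: scalar_prod_def atLeast0LessThan)
  also have "\<dots> = (\<Sum>s<2 * n. if s = r then (if r < n then a r else a (r - n)) * v $ r else 0)"
    by (rule sum.cong) (auto simp: double_diag_index assms)
  finally show ?thesis using assms by simp
qed

lemma symplectic_J_mult_vec:
  assumes "v \<in> carrier_vec (2 * n)" "r < 2 * n"
  shows "(symplectic_J n *\<^sub>v v) $ r = (if r < n then v $ (n + r) else - v $ (r - n))"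
proof -
  have "(symplectic_J n *\<^sub>v v) $ r = (\<Sum>s<2 * n. symplectic_J n $$ (r, s) * v $ s)"
    using assms carrier_matD[OF symplectic_J_carrier[of n]]
    by (simp add: scalar_prod_def atLeast0LessThan)
  also have "\<dots> = (\<Sum>s<2 * n. if s = (if r < n then n + r else r - n)
      then (if r < n then v $ (n + r) else - v $ (r - n)) else 0)"
    by (rule sum.cong) (use assms in \<open>auto simp: symplectic_J_index\<close>)
  also have "\<dots> = (if r < n then v $ (n + r) else - v $ (r - n))"
    using assms by (subst sum.delta) auto
  finally show ?thesis .
qed

lemma scalar_prod_double_diag:
  assumes "v \<in> carrier_vec (2 * n)"
  shows "v \<bullet> (double_diag n a *\<^sub>v v) = (\<Sum>l<n. a l * ((v $ l)\<^sup>2 + (v $ (n + l))\<^sup>2))"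
proof -
  have "v \<bullet> (double_diag n a *\<^sub>v v) = (\<Sum>r<2 * n. v $ r * (double_diag n a *\<^sub>v v) $ r)"
    using carrier_matD[OF double_diag_carrier[of n a]] by (simp add: scalar_prod_def atLeast0LessThan)
  also have "\<dots> = (\<Sum>r<2 * n. v $ r * ((if r < n then a r else a (r - n)) * v $ r))"
    using assms by (simp add: double_diag_mult_vec)
  also have "\<dots> = (\<Sum>l<n. a l * ((v $ l)\<^sup>2 + (v $ (n + l))\<^sup>2))"
    unfolding sum_lessThan_double by (rule sum.cong) (auto simp: power2_eq_square algebra_simps)
  finally show ?thesis .
qed

lemma scalar_prod_symplectic_J:
  assumes "v \<in> carrier_vec (2 * n)" "w \<in> carrier_vec (2 * n)"
  shows "v \<bullet> (symplectic_J n *\<^sub>v w) = (\<Sum>l<n. v $ l * w $ (n + l) - v $ (n + l) * w $ l)"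
proof -
  have "v \<bullet> (symplectic_J n *\<^sub>v w) = (\<Sum>r<2 * n. v $ r * (symplectic_J n *\<^sub>v w) $ r)"
    using carrier_matD[OF symplectic_J_carrier[of n]] by (simp add: scalar_prod_def atLeast0LessThan)
  also have "\<dots> = (\<Sum>r<2 * n. v $ r * (if r < n then w $ (n + r) else - w $ (r - n)))"
    using assms by (simp add: symplectic_J_mult_vec)
  also have "\<dots> = (\<Sum>l<n. v $ l * w $ (n + l) - v $ (n + l) * w $ l)"
    unfolding sum_lessThan_double by (rule sum.cong) auto
  finally show ?thesis .
qed

lemma scalar_prod_congruence:
  fixes R X :: "real mat"
  assumes "R \<in> carrier_mat m m" "X \<in> carrier_mat m m" "v \<in> carrier_vec m" "w \<in> carrier_vec m"
  shows "v \<bullet> ((transpose_mat R * X * R) *\<^sub>v w) = (R *\<^sub>v v) \<bullet> (X *\<^sub>v (R *\<^sub>v w))"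
proof -
  have "(transpose_mat R * X * R) *\<^sub>v w = transpose_mat R *\<^sub>v (X *\<^sub>v (R *\<^sub>v w))"
    using assms by (simp add: assoc_mult_mat_vec[of _ m m _ m])
  then have "v \<bullet> ((transpose_mat R * X * R) *\<^sub>v w) = (transpose_mat R *\<^sub>v (X *\<^sub>v (R *\<^sub>v w))) \<bullet> v"
    using assms by (simp add: comm_scalar_prod[of _ m])
  also have "\<dots> = (X *\<^sub>v (R *\<^sub>v w)) \<bullet> (R *\<^sub>v v)"
    by (rule transpose_vec_mult_scalar[of _ m m]) (use assms in auto)
  also have "\<dots> = (R *\<^sub>v v) \<bullet> (X *\<^sub>v (R *\<^sub>v w))"
    by (rule comm_scalar_prod[of _ m]) (use assms in auto)
  finally show ?thesis .
qed

text \<open>\<open>re_part n x\<close> and \<open>im_part n x\<close> are the real and imaginary part of the vector \<open>(x, - \<i> x)\<close>, on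
  which the Hermitian form of \<open>\<i> J\<close> is positive.\<close>

definition re_part :: "nat \<Rightarrow> (nat \<Rightarrow> complex) \<Rightarrow> real vec" where
  "re_part n x = vec (2 * n) (\<lambda>s. if s < n then Re (x s) else Im (x (s - n)))"

definition im_part :: "nat \<Rightarrow> (nat \<Rightarrow> complex) \<Rightarrow> real vec" where
  "im_part n x = vec (2 * n) (\<lambda>s. if s < n then Im (x s) else - Re (x (s - n)))"

text \<open>Row r of R restricted to vectors (x, - \<i> x): the entry at n + s acquires the factor -
  \<i>.\<close>

definition row_coeff :: "nat \<Rightarrow> real mat \<Rightarrow> nat \<Rightarrow> nat \<Rightarrow> complex" where
  "row_coeff n R r s = Complex (R $$ (r, s)) (- R $$ (r, n + s))"

text \<open>For z = R (x, - \<i> x) this gives the coordinate (z l + \<i> z (n + l)) / 2, and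
  \<open>neg_coord\<close> the one with a minus sign; for R = 1 they are x l and 0. The outer
  \<open>cnj\<close> cancels the conjugation in \<open>cinner\<close>.\<close>

definition pos_coord :: "nat \<Rightarrow> real mat \<Rightarrow> nat \<Rightarrow> nat \<Rightarrow> complex" where
  "pos_coord n R l s = cnj ((row_coeff n R l s + \<i> * row_coeff n R (n + l) s) / 2)"

definition neg_coord :: "nat \<Rightarrow> real mat \<Rightarrow> nat \<Rightarrow> nat \<Rightarrow> complex" where
  "neg_coord n R l s = cnj ((row_coeff n R l s - \<i> * row_coeff n R (n + l) s) / 2)"

lemma part_carrier [simp]: "re_part n x \<in> carrier_vec (2 * n)" "im_part n x \<in> carrier_vec (2 * n)"
  by (simp_all add: re_part_def im_part_def)

lemma row_coeff_sum:
  assumes "R \<in> carrier_mat (2 * n) (2 * n)" "r < 2 * n"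
  shows "(\<Sum>s<n. row_coeff n R r s * x s) = Complex ((R *\<^sub>v re_part n x) $ r) ((R *\<^sub>v im_part n x) $ r)"
proof -
  have 1: "(R *\<^sub>v v) $ r = (\<Sum>s<2 * n. R $$ (r, s) * v $ s)" if "v \<in> carrier_vec (2 * n)" for v
    using assms that by (simp add: scalar_prod_def atLeast0LessThan)
  show ?thesis
    unfolding 1[OF part_carrier(1)] 1[OF part_carrier(2)] sum_lessThan_double
    by (rule complex_eqI)
      (auto simp: row_coeff_def re_part_def im_part_def algebra_simps intro!: sum.cong)
qed

lemma coord_eq:
  fixes x :: "nat \<Rightarrow> complex"
  assumes "R \<in> carrier_mat (2 * n) (2 * n)" "l < n"
  defines "z \<equiv> \<lambda>r. Complex ((R *\<^sub>v re_part n x) $ r) ((R *\<^sub>v im_part n x) $ r)"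
  shows "cinner n (pos_coord n R l) x = (z l + \<i> * z (n + l)) / 2"
    and "cinner n (neg_coord n R l) x = (z l - \<i> * z (n + l)) / 2"
proof -
  have z: "z l = (\<Sum>s<n. row_coeff n R l s * x s)" "z (n + l) = (\<Sum>s<n. row_coeff n R (n + l) s * x s)"
    using assms(2) by (simp_all add: z_def row_coeff_sum[OF assms(1)])
  show "cinner n (pos_coord n R l) x = (z l + \<i> * z (n + l)) / 2"
    unfolding z cinner_def pos_coord_def complex_cnj_cnj
    by (simp add: sum_distrib_left sum_divide_distrib sum.distrib[symmetric] algebra_simps add_divide_distrib)
  show "cinner n (neg_coord n R l) x = (z l - \<i> * z (n + l)) / 2"
    unfolding z cinner_def neg_coord_def complex_cnj_cnj
    by (simp add: sum_distrib_left sum_divide_distrib sum_subtractf[symmetric] algebra_simps diff_divide_distrib)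
qed

text \<open>Parallelogram law and polarization for z l and \<i> z (n + l). The sum feeds the
  weighted form, the difference the symplectic form.\<close>

lemma norm_coord:
  fixes x :: "nat \<Rightarrow> complex"
  assumes "R \<in> carrier_mat (2 * n) (2 * n)" "l < n"
  defines "v \<equiv> R *\<^sub>v re_part n x" and "w \<equiv> R *\<^sub>v im_part n x"
  shows "(cmod (cinner n (pos_coord n R l) x))\<^sup>2 + (cmod (cinner n (neg_coord n R l) x))\<^sup>2 =
      ((v $ l)\<^sup>2 + (v $ (n + l))\<^sup>2 + (w $ l)\<^sup>2 + (w $ (n + l))\<^sup>2) / 2"
    and "(cmod (cinner n (pos_coord n R l) x))\<^sup>2 - (cmod (cinner n (neg_coord n R l) x))\<^sup>2 =
      - (v $ l * w $ (n + l) - v $ (n + l) * w $ l)"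
  unfolding coord_eq[OF assms(1,2)] v_def[symmetric] w_def[symmetric] cmod_power2
  by (simp_all add: power2_eq_square field_simps)

text \<open>The differences of squares add up to minus the symplectic product of the images of
  \<open>re_part\<close> and \<open>im_part\<close>, and R preserves this product.\<close>

lemma krein_frame_symplectic:
  assumes "symplectic n R"
  shows "krein_frame n (pos_coord n R) (neg_coord n R)"
  unfolding krein_frame_def
proof
  fix x :: "nat \<Rightarrow> complex" assume "x \<in> coord_space n"
  have R: "R \<in> carrier_mat (2 * n) (2 * n)" "transpose_mat R * symplectic_J n * R = symplectic_J n"
    using assms by (auto simp: symplectic_def)
  have "(\<Sum>l<n. (cmod (cinner n (pos_coord n R l) x))\<^sup>2 - (cmod (cinner n (neg_coord n R l) x))\<^sup>2) =
    - ((R *\<^sub>v re_part n x) \<bullet> (symplectic_J n *\<^sub>v (R *\<^sub>v im_part n x)))"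
    by (simp add: norm_coord[OF R(1)] scalar_prod_symplectic_J R(1) mult_mat_vec_carrier[OF R(1)]
        sum_negf[symmetric])
  also have "\<dots> = - (re_part n x \<bullet> (symplectic_J n *\<^sub>v im_part n x))"
    using scalar_prod_congruence[OF R(1) symplectic_J_carrier part_carrier(1,2), of x x]
    by (simp add: R(2))
  also have "\<dots> = (\<Sum>l<n. (Re (x l))\<^sup>2 + (Im (x l))\<^sup>2)"
    unfolding scalar_prod_symplectic_J[OF part_carrier] sum_negf[symmetric]
    by (rule sum.cong) (auto simp: re_part_def im_part_def power2_eq_square)
  also have "\<dots> = Re (cinner n x x)" by (simp add: cinner_self cmod_power2)
  finally show "(\<Sum>l<n. (cmod (cinner n (pos_coord n R l) x))\<^sup>2 - (cmod (cinner n (neg_coord n R l) x))\<^sup>2)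
    = Re (cinner n x x)" .
qed

text \<open>Half the Hermitian form of X at (x, - \<i> x); the half compensates for the squared norm
  of that vector being twice that of x.\<close>

lemma weighted_form_congruence:
  fixes a :: "nat \<Rightarrow> real"
  assumes R: "R \<in> carrier_mat (2 * n) (2 * n)"
  defines "X \<equiv> transpose_mat R * double_diag n a * R"
  shows "weighted_form n a (pos_coord n R) (neg_coord n R) x =
    (re_part n x \<bullet> (X *\<^sub>v re_part n x) + im_part n x \<bullet> (X *\<^sub>v im_part n x)) / 2"
  unfolding X_def scalar_prod_congruence[OF R double_diag_carrier part_carrier(1,1)]
    scalar_prod_congruence[OF R double_diag_carrier part_carrier(2,2)]
    scalar_prod_double_diag[OF mult_mat_vec_carrier[OF R part_carrier(1)]]
    scalar_prod_double_diag[OF mult_mat_vec_carrier[OF R part_carrier(2)]]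
    weighted_form_def sum.distrib[symmetric] sum_divide_distrib
  by (rule sum.cong, simp, simp add: norm_coord(1)[OF R], simp add: field_simps)

section \<open>The inequality for Williamson diagonalizations; uniqueness\<close>

lemma symplectic_J_squared: "symplectic_J n * symplectic_J n = - 1\<^sub>m (2 * n)"
proof (rule eq_matI)
  fix r s assume "r < dim_row (- 1\<^sub>m (2 * n) :: real mat)" "s < dim_col (- 1\<^sub>m (2 * n) :: real mat)"
  then have rs: "r < 2 * n" "s < 2 * n" by auto
  have c: "col (symplectic_J n) s \<in> carrier_vec (2 * n)"
    using col_dim[of "symplectic_J n" s] unfolding carrier_matD(1)[OF symplectic_J_carrier] .
  have "(symplectic_J n * symplectic_J n) $$ (r, s) = (symplectic_J n *\<^sub>v col (symplectic_J n) s) $ r"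
    using rs carrier_matD[OF symplectic_J_carrier[of n]] by simp
  also have "\<dots> = (- 1\<^sub>m (2 * n)) $$ (r, s)"
    unfolding symplectic_J_mult_vec[OF c rs(1)]
    using rs carrier_matD[OF symplectic_J_carrier[of n]] by (auto simp: symplectic_J_index)
  finally show "(symplectic_J n * symplectic_J n) $$ (r, s) = (- 1\<^sub>m (2 * n)) $$ (r, s)" .
qed (use carrier_matD[OF symplectic_J_carrier[of n]] in auto)

lemma congruence_mult:
  fixes X :: "real mat"
  assumes "K \<in> carrier_mat m m" "M \<in> carrier_mat m m" "X \<in> carrier_mat m m"
  shows "transpose_mat (K * M) * X * (K * M) = transpose_mat M * (transpose_mat K * X * K) * M"
  using assms by (simp add: transpose_mult[of _ _ m] assoc_mult_mat[of _ m m _ m _ m])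

lemma symplectic_one: "symplectic n (1\<^sub>m (2 * n))"
  by (simp add: symplectic_def left_mult_one_mat[OF symplectic_J_carrier]
      right_mult_one_mat[OF symplectic_J_carrier])

lemma symplectic_mult:
  assumes "symplectic n K" "symplectic n M"
  shows "symplectic n (K * M)"
proof -
  let ?J = "symplectic_J n" and ?c = "carrier_mat (2 * n) (2 * n)"
  have c: "K \<in> ?c" "M \<in> ?c" "transpose_mat K * ?J * K = ?J" "transpose_mat M * ?J * M = ?J"
    using assms by (auto simp: symplectic_def)
  have "transpose_mat (K * M) * ?J * (K * M) = transpose_mat M * (transpose_mat K * ?J * K) * M"
    by (rule congruence_mult[OF c(1,2) symplectic_J_carrier])
  then show ?thesis using c by (simp add: symplectic_def)
qed

lemma symplectic_inverse:
  assumes "symplectic n N"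
  obtains K where "symplectic n K" "K * N = 1\<^sub>m (2 * n)" "N * K = 1\<^sub>m (2 * n)"
proof -
  let ?J = "symplectic_J n" and ?c = "carrier_mat (2 * n) (2 * n)"
  have c: "N \<in> ?c" "transpose_mat N * ?J * N = ?J" using assms by (auto simp: symplectic_def)
  \<comment> \<open>Multiplying N^T J N = J by -J on the left and using J^2 = -1 shows that this is
    a left inverse.\<close>
  define K where "K = - ?J * transpose_mat N * ?J"
  have assoc: "X * Y * Z * W = X * (Y * Z * W)" "X * Y * Z \<in> carrier_mat m m"
    if "X \<in> carrier_mat m m" "Y \<in> carrier_mat m m" "Z \<in> carrier_mat m m" "W \<in> carrier_mat m m"
    for X Y Z W :: "real mat" and m
    using that by (simp_all add: assoc_mult_mat[of _ m m _ m _ m])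
  have mJ: "- ?J \<in> ?c" and tN: "transpose_mat N \<in> ?c" using c(1) by simp_all
  have K: "K \<in> ?c" unfolding K_def by (rule assoc(2)[OF mJ tN symplectic_J_carrier c(1)])
  have "K * N = - ?J * (transpose_mat N * ?J * N)"
    unfolding K_def by (rule assoc(1)[OF mJ tN symplectic_J_carrier c(1)])
  also have "\<dots> = - (?J * ?J)"
    unfolding c(2) by (rule uminus_mult_left_mat) (simp add: carrier_matD[OF symplectic_J_carrier])
  also have "\<dots> = 1\<^sub>m (2 * n)"
    unfolding symplectic_J_squared by (rule eq_matI) auto
  finally have KN: "K * N = 1\<^sub>m (2 * n)" .
  then have NK: "N * K = 1\<^sub>m (2 * n)" by (rule mat_mult_left_right_inverse[OF K c(1)])
  have "transpose_mat K * ?J * K = transpose_mat K * (transpose_mat N * ?J * N) * K"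
    unfolding c(2) ..
  also have "\<dots> = transpose_mat (N * K) * ?J * (N * K)"
    by (rule congruence_mult[OF c(1) K symplectic_J_carrier, symmetric])
  also have "\<dots> = ?J" unfolding NK using symplectic_one[of n] unfolding symplectic_def by (rule conjunct2)
  finally have "symplectic n K" using K unfolding symplectic_def by (intro conjI)
  from this KN NK show ?thesis by (rule that)
qed

text \<open>As K inverts N, A = K^T D K; so A in the coordinates of M is D in those of K M.\<close>

lemma congruence_change:
  fixes A :: "real mat"
  assumes "A \<in> carrier_mat m m" "N \<in> carrier_mat m m" "K \<in> carrier_mat m m" "M \<in> carrier_mat m m"
    and "N * K = 1\<^sub>m m" "transpose_mat N * A * N = D"
  shows "transpose_mat (K * M) * D * (K * M) = transpose_mat M * A * M"
proof -
  have "transpose_mat (K * M) * D * (K * M) =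
      transpose_mat M * (transpose_mat (N * K) * A * (N * K)) * M"
    unfolding assms(6)[symmetric] congruence_mult[OF assms(2,3,1)]
    using assms(1-4) by (intro congruence_mult) auto
  then show ?thesis using assms by simp
qed

text \<open>All forms are moved to the coordinates of M, where A + B is diagonal; A and B become
  congruent to their normal forms through K M and L M. Nonnegative weights also admit B = 0.\<close>

theorem lidskii_matrices:
  fixes A B :: "real mat"
  assumes carrier: "A \<in> carrier_mat (2 * n) (2 * n)" "B \<in> carrier_mat (2 * n) (2 * n)"
    and N: "symplectic n N" "transpose_mat N * A * N = double_diag n a"
    and N': "symplectic n N'" "transpose_mat N' * B * N' = double_diag n b"
    and M: "symplectic n M" "transpose_mat M * (A + B) * M = double_diag n c"
    and a: "mono_on {..<n} a" "\<And>l. l < n \<Longrightarrow> 0 \<le> a l"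
    and b: "mono_on {..<n} b" "\<And>l. l < n \<Longrightarrow> 0 \<le> b l"
    and c: "mono_on {..<n} c"
    and "is": "sorted_wrt (<) is" "\<forall>i\<in>set is. i < n"
  shows "(\<Sum>i\<leftarrow>is. a i) + (\<Sum>j<length is. b j) \<le> (\<Sum>i\<leftarrow>is. c i)"
proof -
  obtain K where K: "symplectic n K" "N * K = 1\<^sub>m (2 * n)" by (rule symplectic_inverse[OF N(1)])
  obtain L where L: "symplectic n L" "N' * L = 1\<^sub>m (2 * n)" by (rule symplectic_inverse[OF N'(1)])
  note sc = N(1) N'(1) M(1) K(1) L(1)
  have cm: "N \<in> carrier_mat (2 * n) (2 * n)" "N' \<in> carrier_mat (2 * n) (2 * n)"
    "M \<in> carrier_mat (2 * n) (2 * n)" "K \<in> carrier_mat (2 * n) (2 * n)" "L \<in> carrier_mat (2 * n) (2 * n)"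
    using sc by (simp_all add: symplectic_def)
  have KM: "K * M \<in> carrier_mat (2 * n) (2 * n)" and LM: "L * M \<in> carrier_mat (2 * n) (2 * n)"
    using cm by auto
  define X where "X = transpose_mat M * A * M"
  define Y where "Y = transpose_mat M * B * M"
  have XY: "X \<in> carrier_mat (2 * n) (2 * n)" "Y \<in> carrier_mat (2 * n) (2 * n)"
    using cm carrier by (auto simp: X_def Y_def)
  have XYc: "X + Y = double_diag n c"
    unfolding M(2)[symmetric] X_def Y_def using cm carrier
    by (simp add: mult_add_distrib_mat[of _ "2 * n" "2 * n"] add_mult_distrib_mat[of _ "2 * n" "2 * n"])
  have X: "transpose_mat (K * M) * double_diag n a * (K * M) = X"
    unfolding X_def by (rule congruence_change[OF carrier(1) cm(1,4,3) K(2) N(2)])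
  have Y: "transpose_mat (L * M) * double_diag n b * (L * M) = Y"
    unfolding Y_def by (rule congruence_change[OF carrier(2) cm(2,5,3) L(2) N'(2)])
  have add: "v \<bullet> (X *\<^sub>v v) + v \<bullet> (Y *\<^sub>v v) = v \<bullet> (double_diag n c *\<^sub>v v)"
    if "v \<in> carrier_vec (2 * n)" for v
    unfolding XYc[symmetric] using that XY
    by (simp add: add_mult_distrib_mat_vec[of _ "2 * n" "2 * n"] scalar_prod_add_distrib[of _ "2 * n"])
  show ?thesis
  proof (rule lidskii_forms[OF krein_frame_symplectic[OF symplectic_mult[OF K(1) M(1)]]
        krein_frame_symplectic[OF symplectic_mult[OF L(1) M(1)]] a b c _ "is"])
    fix x :: "nat \<Rightarrow> complex" assume "x \<in> coord_space n"
    have "weighted_form n a (pos_coord n (K * M)) (neg_coord n (K * M)) x +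
        weighted_form n b (pos_coord n (L * M)) (neg_coord n (L * M)) x =
        (re_part n x \<bullet> (double_diag n c *\<^sub>v re_part n x) +
         im_part n x \<bullet> (double_diag n c *\<^sub>v im_part n x)) / 2"
      unfolding weighted_form_congruence[OF KM] weighted_form_congruence[OF LM] X Y
      by (simp add: add[symmetric] add_divide_distrib)
    \<comment> \<open>For a diagonal matrix the real and the imaginary part contribute equally,
      which cancels the half.\<close>
    also have "\<dots> = (\<Sum>l<n. c l * (cmod (x l))\<^sup>2)"
      unfolding scalar_prod_double_diag[OF part_carrier(1)] scalar_prod_double_diag[OF part_carrier(2)]
        sum.distrib[symmetric] sum_divide_distrib
      by (rule sum.cong) (auto simp: re_part_def im_part_def cmod_power2 field_simps)
    finally show "weighted_form n a (pos_coord n (K * M)) (neg_coord n (K * M)) x +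
        weighted_form n b (pos_coord n (L * M)) (neg_coord n (L * M)) x =
        (\<Sum>l<n. c l * (cmod (x l))\<^sup>2)" .
  qed
qed

lemma williamson_formE:
  assumes "williamson_form n A ds"
  obtains M where "symplectic n M" "transpose_mat M * A * M = double_diag n (\<lambda>i. ds ! i)"
    "length ds = n" "mono_on {..<n} (\<lambda>i. ds ! i)" "\<forall>l<n. 0 < ds ! l"
proof -
  from assms obtain M where M: "symplectic n M" "transpose_mat M * A * M = double_diag n (\<lambda>i. ds ! i)"
    unfolding williamson_form_def double_diag_def by blast
  have "length ds = n" "mono_on {..<n} (\<lambda>i. ds ! i)" "\<forall>l<n. 0 < ds ! l"
    using assms by (auto simp: williamson_form_def mono_on_def sorted_iff_nth_mono)
  from that[OF M this] show ?thesis .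
qed

text \<open>Lidskii with B = 0 and one index, with \<open>ds\<close> as normal form of A and
  \<open>es\<close> as that of A + 0; exchanging the two gives uniqueness.\<close>

lemma williamson_form_le:
  assumes A: "A \<in> carrier_mat (2 * n) (2 * n)"
    and "williamson_form n A ds" "williamson_form n A es" "i < n"
  shows "ds ! i \<le> es ! i"
proof -
  obtain N where N: "symplectic n N" "transpose_mat N * A * N = double_diag n (\<lambda>i. ds ! i)"
    "length ds = n" "mono_on {..<n} (\<lambda>i. ds ! i)" "\<forall>l<n. 0 < ds ! l"
    by (rule williamson_formE[OF assms(2)])
  obtain M where M: "symplectic n M" "transpose_mat M * A * M = double_diag n (\<lambda>i. es ! i)"
    "length es = n" "mono_on {..<n} (\<lambda>i. es ! i)" "\<forall>l<n. 0 < es ! l"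
    by (rule williamson_formE[OF assms(3)])
  have c: "N \<in> carrier_mat (2 * n) (2 * n)" using N(1) by (simp add: symplectic_def)
  have "double_diag n (\<lambda>i. 0) = 0\<^sub>m (2 * n) (2 * n)"
    using carrier_matD[OF double_diag_carrier[of n]] by (intro eq_matI) (auto simp: double_diag_index)
  then have z: "transpose_mat N * 0\<^sub>m (2 * n) (2 * n) * N = double_diag n (\<lambda>i. 0)" using c by simp
  have "transpose_mat M * (A + 0\<^sub>m (2 * n) (2 * n)) * M = double_diag n (\<lambda>i. es ! i)"
    using M(2) A by simp
  from lidskii_matrices[OF A zero_carrier_mat N(1,2) N(1) z M(1) this N(4) _ _ _ M(4), of "[i]"]
  show ?thesis using N(5) assms(4) by (simp add: mono_on_def less_imp_le)
qed

lemma williamson_form_unique: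
  assumes "A \<in> carrier_mat (2 * n) (2 * n)" "williamson_form n A ds" "williamson_form n A es"
  shows "ds = es"
proof (rule nth_equalityI)
  show "length ds = length es" using assms by (simp add: williamson_form_def)
  fix i assume "i < length ds"
  then have "i < n" using assms by (simp add: williamson_form_def)
  then show "ds ! i = es ! i"
    using williamson_form_le[OF assms] williamson_form_le[OF assms(1,3,2)] by (simp add: antisym)
qed

lemma symplectic_eigenvalues_eq:
  assumes "A \<in> carrier_mat (2 * n) (2 * n)" "williamson_form n A ds"
  shows "symplectic_eigenvalues n A = ds"
  unfolding symplectic_eigenvalues_def
  by (rule the_equality) (use assms williamson_form_unique in auto)

lemma williamson_form_one: "williamson_form n (1\<^sub>m (2 * n)) (replicate n 1)"
proof -
  have "double_diag n (\<lambda>i. replicate n 1 ! i) = 1\<^sub>m (2 * n)"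
    using carrier_matD[OF double_diag_carrier[of n]] by (intro eq_matI) (auto simp: double_diag_index)
  with symplectic_one show ?thesis
    by (auto simp: williamson_form_def double_diag_def sorted_replicate intro!: exI[of _ "1\<^sub>m (2 * n)"])
qed

section \<open>Eigenvectors of the pencil of a positive definite matrix and \<open>\<i> J\<close>\<close>

definition poly_act ::
  "((nat \<Rightarrow> complex) \<Rightarrow> (nat \<Rightarrow> complex)) \<Rightarrow> complex poly \<Rightarrow> (nat \<Rightarrow> complex) \<Rightarrow> nat \<Rightarrow> complex" where
  "poly_act T p v = (\<lambda>r. \<Sum>k\<le>degree p. coeff p k * ((T ^^ k) v) r)"

lemma poly_act_altdef:
  assumes "degree p \<le> d"
  shows "poly_act T p v r = (\<Sum>k\<le>d. coeff p k * ((T ^^ k) v) r)"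
  unfolding poly_act_def
  by (rule sum.mono_neutral_left) (use assms in \<open>auto simp: coeff_eq_0\<close>)

lemma poly_act_linear_factor:
  assumes lin: "\<And>a x b y. T (lin_comb a x b y) = lin_comb a (T x) b (T y)"
  shows "poly_act T ([:-z, 1:] * q) v = poly_act T q (lin_comb 1 (T v) (-z) v)"
proof
  fix r
  define d where "d = degree q"
  have pow: "(T ^^ k) (lin_comb 1 (T v) (-z) v) = lin_comb 1 ((T ^^ Suc k) v) (-z) ((T ^^ k) v)" for k
    by (induction k) (simp_all add: lin)
  have eq: "[:-z, 1:] * q = pCons 0 q + smult (-z) q" by simp
  have deg: "degree ([:-z, 1:] * q) \<le> Suc d"
    using degree_mult_le[of "[:-z, 1:]" q] by (simp add: d_def)
  have "poly_act T ([:-z, 1:] * q) v r =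
      (\<Sum>k\<le>Suc d. coeff (pCons 0 q) k * ((T ^^ k) v) r) +
      (\<Sum>k\<le>Suc d. - z * coeff q k * ((T ^^ k) v) r)"
    unfolding poly_act_altdef[OF deg]
    unfolding eq coeff_add coeff_smult distrib_right sum.distrib ..
  also have "(\<Sum>k\<le>Suc d. coeff (pCons 0 q) k * ((T ^^ k) v) r) =
      (\<Sum>k\<le>d. coeff q k * ((T ^^ Suc k) v) r)"
    unfolding sum.atMost_Suc_shift by simp
  also have "(\<Sum>k\<le>Suc d. - z * coeff q k * ((T ^^ k) v) r) = (\<Sum>k\<le>d. - z * coeff q k * ((T ^^ k) v) r)"
    by (simp add: d_def coeff_eq_0)
  also have "(\<Sum>k\<le>d. coeff q k * ((T ^^ Suc k) v) r) + (\<Sum>k\<le>d. - z * coeff q k * ((T ^^ k) v) r) =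
      poly_act T q (lin_comb 1 (T v) (-z) v) r"
    unfolding poly_act_def d_def[symmetric] pow sum.distrib[symmetric]
    by (rule sum.cong) (simp_all add: lin_comb_def algebra_simps)
  finally show "poly_act T ([:-z, 1:] * q) v r = poly_act T q (lin_comb 1 (T v) (-z) v) r" .
qed

text \<open>Write p = (X - z) q with a root z. Either (T - z) v = 0 and v is an eigenvector, or (T -
  z) v is a nonzero vector of S annihilated by q(T), and the degree has dropped.\<close>

lemma eigenvector_from_poly:
  assumes lin: "\<And>a x b y. T (lin_comb a x b y) = lin_comb a (T x) b (T y)"
    and S: "\<And>a x b y. x \<in> S \<Longrightarrow> y \<in> S \<Longrightarrow> lin_comb a x b y \<in> S" "\<And>x. x \<in> S \<Longrightarrow> T x \<in> S"
    and "p \<noteq> 0" "v \<in> S" "v \<noteq> (\<lambda>_. 0)" "poly_act T p v = (\<lambda>_. 0)"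
  shows "\<exists>w\<in>S. w \<noteq> (\<lambda>_. 0) \<and> (\<exists>z. T w = (\<lambda>r. z * w r))"
  using assms(4-)
proof (induction "degree p" arbitrary: p v rule: less_induct)
  case less
  show ?case
  proof (cases "degree p = 0")
    case True
    then obtain c where c: "p = [:c:]" by (rule degree_eq_zeroE)
    have "c * v r = 0" for r
      using fun_cong[OF less.prems(4), of r] by (simp add: poly_act_def c)
    then have "v = (\<lambda>_. 0)" using less.prems(1) c by (auto simp: fun_eq_iff)
    with less.prems(3) show ?thesis by simp
  next
    case False
    then have "\<not> constant (poly p)" by (simp add: constant_degree)
    then obtain z where "poly p z = 0" using fundamental_theorem_of_algebra by blast
    then obtain q where q: "p = [:-z, 1:] * q" unfolding poly_eq_0_iff_dvd by (rule dvdE)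
    have "q \<noteq> 0" using q less.prems(1) by auto
    then have "degree p = Suc (degree q)" unfolding q by (subst degree_mult_eq) auto
    define w where "w = lin_comb 1 (T v) (-z) v"
    show ?thesis
    proof (cases "w = (\<lambda>_. 0)")
      case True
      have "T v r = z * v r" for r
        using fun_cong[OF True, of r] by (simp add: w_def lin_comb_def)
      then show ?thesis using less.prems(2,3) by blast
    next
      case False
      have "w \<in> S" unfolding w_def using S less.prems(2) by blast
      moreover have "poly_act T q w = (\<lambda>_. 0)"
        using less.prems(4) unfolding q poly_act_linear_factor[OF lin] w_def .
      moreover have "degree q < degree p" using \<open>degree p = _\<close> by simp
      ultimately show ?thesis using less.hyps[of q w] \<open>q \<noteq> 0\<close> False by blast
    qed
  qed
qed

text \<open>The N + 1 vectors v, T v, ..., T^N v of an N-dimensional space are dependent, which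
  gives a polynomial annihilating v.\<close>

lemma eigenvector_in_invariant_subspace:
  assumes lin: "\<And>a x b y. T (lin_comb a x b y) = lin_comb a (T x) b (T y)"
    and S: "\<And>a x b y. x \<in> S \<Longrightarrow> y \<in> S \<Longrightarrow> lin_comb a x b y \<in> S" "\<And>x. x \<in> S \<Longrightarrow> T x \<in> S"
    and "S \<subseteq> coord_space N" "v \<in> S" "v \<noteq> (\<lambda>_. 0)"
  shows "\<exists>w\<in>S. w \<noteq> (\<lambda>_. 0) \<and> (\<exists>z. T w = (\<lambda>r. z * w r))"
proof -
  \<comment> \<open>Row r lists the r-th coordinates of the T^k v, conjugated to suit
    \<open>cinner\<close>; a vector orthogonal to all N rows is a linear relation.\<close>
  define zs where "zs = map (\<lambda>r k. cnj (((T ^^ k) v) r)) [0..<N]"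
  have "length zs < Suc N" "Suc N \<le> Suc N" by (simp_all add: zs_def)
  then obtain c where c: "c \<in> coord_space (Suc N)" "cinner (Suc N) c c = 1"
    "\<forall>z\<in>set zs. cinner (Suc N) z c = 0"
    by (rule exists_unit_orthogonal)
  define p where "p = (\<Sum>k\<le>N. monom (c k) k)"
  have coeff: "coeff p k = c k" if "k \<le> N" for k
    unfolding p_def coeff_sum using that by simp
  have deg: "degree p \<le> N" unfolding p_def
    by (rule degree_sum_le) (auto intro: order.trans[OF degree_monom_le])
  have "p \<noteq> 0"
  proof
    assume "p = 0"
    then have "\<forall>k<Suc N. c k = 0" using coeff by (auto simp: less_Suc_eq_le)
    then have "cinner (Suc N) c c = 0" by (simp add: cinner_self_eq_0)
    with c(2) show False by simp
  qed
  have powS: "(T ^^ k) v \<in> S" for k by (induction k) (use assms(5) S(2) in auto)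
  have "poly_act T p v r = 0" for r
  proof (cases "r < N")
    case True
    have "poly_act T p v r = (\<Sum>k\<le>N. c k * ((T ^^ k) v) r)"
      unfolding poly_act_altdef[OF deg] by (rule sum.cong) (simp_all add: coeff)
    also have "\<dots> = cinner (Suc N) (\<lambda>k. cnj (((T ^^ k) v) r)) c"
      by (simp add: cinner_def lessThan_Suc_atMost mult.commute)
    also have "\<dots> = 0" using c(3) True by (simp add: zs_def)
    finally show ?thesis .
  next
    case False
    then have "((T ^^ k) v) r = 0" for k using powS[of k] assms(4) by (auto simp: coord_space_def)
    then show ?thesis by (simp add: poly_act_def)
  qed
  then have "poly_act T p v = (\<lambda>_. 0)" by blast
  from eigenvector_from_poly[OF lin S \<open>p \<noteq> 0\<close> assms(5,6) this] show ?thesis by blast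
qed

section \<open>The operators of A and \<open>\<i> J\<close> on complex vectors\<close>

definition mat_op :: "nat \<Rightarrow> real mat \<Rightarrow> (nat \<Rightarrow> complex) \<Rightarrow> nat \<Rightarrow> complex" where
  "mat_op N X x = (\<lambda>r. if r < N then \<Sum>s<N. of_real (X $$ (r, s)) * x s else 0)"

text \<open>The operator \<open>\<i> J\<close>.\<close>

definition krein_op :: "nat \<Rightarrow> (nat \<Rightarrow> complex) \<Rightarrow> nat \<Rightarrow> complex" where
  "krein_op n x = (\<lambda>r. if r < n then \<i> * x (n + r) else if r < 2 * n then - \<i> * x (r - n) else 0)"

definition conj_fun :: "(nat \<Rightarrow> complex) \<Rightarrow> nat \<Rightarrow> complex" where
  "conj_fun x = (\<lambda>r. cnj (x r))"

lemma mat_op_lin_comb: "mat_op N X (lin_comb a x b y) = lin_comb a (mat_op N X x) b (mat_op N X y)"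
  by (auto simp: fun_eq_iff mat_op_def lin_comb_def sum.distrib sum_distrib_left algebra_simps)

lemma krein_op_lin_comb: "krein_op n (lin_comb a x b y) = lin_comb a (krein_op n x) b (krein_op n y)"
  by (auto simp: fun_eq_iff krein_op_def lin_comb_def algebra_simps)

lemma mat_op_coord_space: "mat_op N X x \<in> coord_space N"
  by (simp add: mat_op_def coord_space_def)

lemma krein_op_coord_space: "krein_op n x \<in> coord_space (2 * n)"
  by (simp add: krein_op_def coord_space_def)

lemma krein_op_krein_op: "x \<in> coord_space (2 * n) \<Longrightarrow> krein_op n (krein_op n x) = x"
  by (auto simp: fun_eq_iff krein_op_def coord_space_def)

lemma krein_op_scale: "krein_op n (\<lambda>r. c * x r) = (\<lambda>r. c * krein_op n x r)"
  by (auto simp: fun_eq_iff krein_op_def)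

lemma mat_op_scale: "mat_op N X (\<lambda>r. c * x r) = (\<lambda>r. c * mat_op N X x r)"
  by (auto simp: fun_eq_iff mat_op_def sum_distrib_left algebra_simps)

lemma mat_op_conj: "mat_op N X (conj_fun x) = conj_fun (mat_op N X x)"
  by (auto simp: fun_eq_iff mat_op_def conj_fun_def)

text \<open>The entries of \<open>\<i> J\<close> are purely imaginary. Hence conjugating an
  eigenvector of the pencil negates a real eigenvalue.\<close>

lemma krein_op_conj: "krein_op n (conj_fun x) = (\<lambda>r. - conj_fun (krein_op n x) r)"
  by (auto simp: fun_eq_iff krein_op_def conj_fun_def)

lemma conj_fun_conj_fun [simp]: "conj_fun (conj_fun x) = x"
  by (simp add: conj_fun_def)

lemma conj_fun_coord_space: "x \<in> coord_space N \<Longrightarrow> conj_fun x \<in> coord_space N"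
  by (simp add: conj_fun_def coord_space_def)

lemma cinner_scale_right: "cinner n x (\<lambda>r. c * y r) = c * cinner n x y"
  by (simp add: cinner_def sum_distrib_left algebra_simps)

lemma cinner_scale_left: "cinner n (\<lambda>r. c * x r) y = cnj c * cinner n x y"
  by (simp add: cinner_def sum_distrib_left algebra_simps)

lemma cinner_uminus_right: "cinner n x (\<lambda>r. - y r) = - cinner n x y"
  by (simp add: cinner_def sum_negf)

lemma cinner_conj_right: "cinner n x (conj_fun y) = cnj (cinner n (conj_fun x) y)"
  by (simp add: cinner_def conj_fun_def)

lemma cinner_conj_conj: "cinner n (conj_fun x) (conj_fun y) = cnj (cinner n x y)"
  by (simp add: cinner_def conj_fun_def)

lemma cinner_krein_op:
  "cinner (2 * n) x (krein_op n y) = (\<Sum>l<n. \<i> * (cnj (x l) * y (n + l) - cnj (x (n + l)) * y l))"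
  unfolding cinner_def sum_lessThan_double
  by (rule sum.cong) (simp_all add: krein_op_def algebra_simps)

lemma krein_op_hermitian: "cinner (2 * n) (krein_op n x) y = cinner (2 * n) x (krein_op n y)"
  unfolding cinner_krein_op
  unfolding cinner_def sum_lessThan_double
  by (rule sum.cong) (simp_all add: krein_op_def algebra_simps)

lemma mat_op_hermitian:
  assumes "X \<in> carrier_mat N N" "transpose_mat X = X"
  shows "cinner N (mat_op N X x) y = cinner N x (mat_op N X y)"
proof -
  have sym: "X $$ (s, r) = X $$ (r, s)" if "r < N" "s < N" for r s
    using index_transpose_mat(1)[of r X s] assms that by auto
  have "cinner N (mat_op N X x) y = (\<Sum>r<N. \<Sum>s<N. of_real (X $$ (r, s)) * cnj (x s) * y r)"
    unfolding cinner_def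
    by (rule sum.cong) (simp_all add: mat_op_def sum_distrib_right)
  also have "\<dots> = (\<Sum>s<N. \<Sum>r<N. of_real (X $$ (r, s)) * cnj (x s) * y r)"
    by (rule sum.swap)
  also have "\<dots> = cinner N x (mat_op N X y)"
    unfolding cinner_def
    by (rule sum.cong) (simp_all add: mat_op_def sum_distrib_left sym mult_ac)
  finally show ?thesis .
qed

text \<open>At x = p + \<i> q the cross terms drop out of the real part, leaving the real forms at p
  and at q.\<close>

lemma cinner_mat_op_pos:
  assumes "X \<in> pos_def_mats N" "x \<in> coord_space N" "x \<noteq> (\<lambda>_. 0)"
  shows "Re (cinner N x (mat_op N X x)) > 0"
proof -
  have X: "X \<in> carrier_mat N N" and pos: "\<And>v. v \<in> carrier_vec N \<Longrightarrow> v \<noteq> 0\<^sub>v N \<Longrightarrow> v \<bullet> (X *\<^sub>v v) > 0"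
    using assms(1) by (auto simp: pos_def_mats_def)
  define p where "p = vec N (\<lambda>r. Re (x r))"
  define q where "q = vec N (\<lambda>r. Im (x r))"
  have form: "vec N f \<bullet> (X *\<^sub>v vec N f) = (\<Sum>r<N. \<Sum>s<N. f r * X $$ (r, s) * f s)" for f
    using X by (simp add: scalar_prod_def atLeast0LessThan sum_distrib_left mult_ac)
  have "Re (cinner N x (mat_op N X x)) = (\<Sum>r<N. \<Sum>s<N. Re (cnj (x r) * (of_real (X $$ (r, s)) * x s)))"
    by (simp add: cinner_def mat_op_def sum_distrib_left)
  also have "\<dots> = p \<bullet> (X *\<^sub>v p) + q \<bullet> (X *\<^sub>v q)"
    unfolding p_def q_def form sum.distrib[symmetric]
    by (intro sum.cong refl) (simp add: algebra_simps)
  finally have eq: "Re (cinner N x (mat_op N X x)) = p \<bullet> (X *\<^sub>v p) + q \<bullet> (X *\<^sub>v q)" .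
  have nonneg: "v \<bullet> (X *\<^sub>v v) \<ge> 0" if "v \<in> carrier_vec N" for v
  proof (cases "v = 0\<^sub>v N")
    case True
    then show ?thesis using X by simp
  qed (use pos[OF that] in simp)
  have pq: "p \<in> carrier_vec N" "q \<in> carrier_vec N" by (simp_all add: p_def q_def)
  have "p \<noteq> 0\<^sub>v N \<or> q \<noteq> 0\<^sub>v N"
  proof (rule ccontr)
    assume "\<not> ?thesis"
    then have pq0: "p = 0\<^sub>v N" "q = 0\<^sub>v N" by auto
    have "x r = 0" for r
    proof (cases "r < N")
      case True
      have "p $ r = 0" "q $ r = 0" unfolding pq0 using True by simp_all
      then show ?thesis using True by (simp add: p_def q_def complex_eq_iff)
    qed (use assms(2) in \<open>simp add: coord_space_def\<close>)
    with assms(3) show False by blast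
  qed
  then show ?thesis
    unfolding eq using pos[OF pq(1)] pos[OF pq(2)] nonneg[OF pq(1)] nonneg[OF pq(2)]
    by (auto intro: add_pos_nonneg add_nonneg_pos)
qed

text \<open>Positive-type eigenvectors of the pencil, orthonormal for \<open>\<i> J\<close>; m
  counts those found so far.\<close>

definition krein_eigenbasis ::
  "nat \<Rightarrow> real mat \<Rightarrow> nat \<Rightarrow> (nat \<Rightarrow> real) \<Rightarrow> (nat \<Rightarrow> nat \<Rightarrow> complex) \<Rightarrow> bool" where
  "krein_eigenbasis n A m d u \<longleftrightarrow>
     (\<forall>j<m. u j \<in> coord_space (2 * n) \<and> 0 < d j \<and>
        mat_op (2 * n) A (u j) = (\<lambda>r. of_real (d j) * krein_op n (u j) r) \<and>
        (\<forall>i<m. cinner (2 * n) (u i) (krein_op n (u j)) = (if i = j then 1 else 0)))"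

lemma krein_eigenbasis_extend:
  assumes A: "A \<in> pos_def_mats (2 * n)" and basis: "krein_eigenbasis n A m d u" and "m < n"
  shows "\<exists>d u. krein_eigenbasis n A (Suc m) d u"
proof -
  let ?A = "mat_op (2 * n) A" and ?G = "krein_op n"
  have carrier: "A \<in> carrier_mat (2 * n) (2 * n)" "transpose_mat A = A"
    using A by (auto simp: pos_def_mats_def)
  note herm = mat_op_hermitian[OF carrier]
  \<comment> \<open>The complement, with respect to \<open>\<i> J\<close>, of the u j and their
    conjugates; the second condition makes it closed under conjugation.\<close>
  define S where "S = {y \<in> coord_space (2 * n). \<forall>j<m.
    cinner (2 * n) (?G (u j)) y = 0 \<and> cinner (2 * n) (?G (u j)) (conj_fun y) = 0}"
  \<comment> \<open>Since \<open>\<i> J\<close> is an involution, T w = z w is the pencil equation A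
    w = z (\<i> J) w.\<close>
  define T where "T = (\<lambda>x. ?G (?A x))"
  have S_conj: "conj_fun y \<in> S" if "y \<in> S" for y
    using that by (simp add: S_def conj_fun_coord_space)
  have GA: "cinner (2 * n) (?G (u j)) (?G (?A y)) = of_real (d j) * cinner (2 * n) (?G (u j)) y"
    if "j < m" for j y
  proof -
    have "cinner (2 * n) (?G (u j)) (?G (?A y)) = cinner (2 * n) (?A (u j)) y"
      unfolding krein_op_hermitian herm krein_op_krein_op[OF mat_op_coord_space] ..
    also have "\<dots> = of_real (d j) * cinner (2 * n) (?G (u j)) y"
      using basis that by (simp add: krein_eigenbasis_def cinner_scale_left)
    finally show ?thesis .
  qed
  have T_S: "T y \<in> S" if "y \<in> S" for y
  proof -
    have "conj_fun (T y) = (\<lambda>r. - ?G (?A (conj_fun y)) r)"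
      unfolding T_def mat_op_conj krein_op_conj by simp
    then show ?thesis using that
      by (simp add: S_def T_def GA krein_op_coord_space cinner_uminus_right)
  qed
  have lin_S: "lin_comb a x b y \<in> S" if "x \<in> S" "y \<in> S" for a x b y
  proof -
    have "conj_fun (lin_comb a x b y) = lin_comb (cnj a) (conj_fun x) (cnj b) (conj_fun y)"
      by (simp add: conj_fun_def lin_comb_def)
    then show ?thesis using that by (simp add: S_def lin_comb_coord_space cinner_lin_comb)
  qed
  have "\<exists>v\<in>S. v \<noteq> (\<lambda>_. 0)"
  proof -
    \<comment> \<open>S is cut out by 2 m < 2 n equations, so it is not zero.\<close>
    define zs where "zs = map (\<lambda>j. ?G (u j)) [0..<m] @ map (\<lambda>j. conj_fun (?G (u j))) [0..<m]"
    have "length zs < 2 * n" "2 * n \<le> 2 * n" using \<open>m < n\<close> by (simp_all add: zs_def)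
    then obtain v where v: "v \<in> coord_space (2 * n)" "cinner (2 * n) v v = 1"
      "\<forall>z\<in>set zs. cinner (2 * n) z v = 0"
      by (rule exists_unit_orthogonal)
    then have "v \<in> S" by (auto simp: S_def zs_def cinner_conj_right)
    moreover have "v \<noteq> (\<lambda>_. 0)" using v(2) by (auto simp: cinner_def)
    ultimately show ?thesis by blast
  qed
  then obtain v where "v \<in> S" "v \<noteq> (\<lambda>_. 0)" by blast
  have T_lin: "T (lin_comb a x b y) = lin_comb a (T x) b (T y)" for a x b y
    by (simp add: T_def mat_op_lin_comb krein_op_lin_comb)
  have "S \<subseteq> coord_space (2 * n)" by (auto simp: S_def)
  from eigenvector_in_invariant_subspace[of T S, OF T_lin lin_S T_S this \<open>v \<in> S\<close> \<open>v \<noteq> _\<close>]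
  obtain w z where w: "w \<in> S" "w \<noteq> (\<lambda>_. 0)" and Tw: "T w = (\<lambda>r. z * w r)" by blast
  have wN: "w \<in> coord_space (2 * n)" using w(1) by (simp add: S_def)
  have Aw: "?A w = (\<lambda>r. z * ?G w r)"
    using arg_cong[OF Tw, of ?G] unfolding T_def krein_op_krein_op[OF mat_op_coord_space] krein_op_scale .
  define g where "g = Re (cinner (2 * n) w (?G w))"
  have "cinner (2 * n) w (?G w) = cnj (cinner (2 * n) w (?G w))"
    using cinner_commute[of "2 * n" "?G w" w] unfolding krein_op_hermitian .
  then have g: "cinner (2 * n) w (?G w) = of_real g"
    by (simp add: g_def complex_eq_iff)
  have "cinner (2 * n) w (?A w) = cnj (cinner (2 * n) w (?A w))"
    using cinner_commute[of "2 * n" "?A w" w] unfolding herm .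
  then have im: "Im (cinner (2 * n) w (?A w)) = 0" by (simp add: complex_eq_iff)
  have wAw: "cinner (2 * n) w (?A w) = z * of_real g"
    unfolding Aw cinner_scale_right g ..
  have "Re (cinner (2 * n) w (?A w)) > 0"
    by (rule cinner_mat_op_pos[OF A wN w(2)])
  \<comment> \<open>The positive number w^* A w equals z g with g real; so g is nonzero, z is real,
    and their signs agree.\<close>
  then have zg: "Re z * g > 0" and "Im z * g = 0" using im unfolding wAw by simp_all
  then have z: "z = of_real (Re z)" by (auto simp: complex_eq_iff)
  have "\<exists>w e g. w \<in> S \<and> 0 < e \<and> 0 < g \<and> ?A w = (\<lambda>r. of_real e * ?G w r) \<and>
    cinner (2 * n) w (?G w) = of_real g"
  proof (cases "g > 0")
    case True
    then have "Re z > 0" using zg by (simp add: zero_less_mult_iff)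
    moreover have "?A w = (\<lambda>r. of_real (Re z) * ?G w r)" using Aw z by simp
    ultimately show ?thesis using w g True by blast
  next
    case False
    then have neg: "- Re z > 0" "- g > 0" using zg by (auto simp: zero_less_mult_iff)
    \<comment> \<open>If w has negative type, its conjugate has positive type and eigenvalue -
      z.\<close>
    have "?A (conj_fun w) = (\<lambda>r. of_real (- Re z) * ?G (conj_fun w) r)"
      unfolding mat_op_conj Aw krein_op_conj
      by (subst z) (simp add: conj_fun_def)
    moreover have "cinner (2 * n) (conj_fun w) (?G (conj_fun w)) = of_real (- g)"
      unfolding krein_op_conj cinner_uminus_right cinner_conj_conj g by simp
    ultimately show ?thesis using neg S_conj[OF w(1)] by blast
  qed
  then obtain w e g where w: "w \<in> S" "0 < e" "0 < g" and Aw: "?A w = (\<lambda>r. of_real e * ?G w r)"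
    and g: "cinner (2 * n) w (?G w) = of_real g" by blast
  define c where "c = 1 / sqrt g"
  have c: "c * c * g = 1" using \<open>0 < g\<close> by (simp add: c_def)
  define y where "y = (\<lambda>r. of_real c * w r)"
  have yN: "y \<in> coord_space (2 * n)" using w(1) by (simp add: S_def y_def coord_space_def)
  have yA: "?A y = (\<lambda>r. of_real e * ?G y r)"
    unfolding y_def mat_op_scale krein_op_scale Aw by (simp add: fun_eq_iff)
  have "cinner (2 * n) y (?G y) = of_real (c * c * g)"
    unfolding y_def krein_op_scale cinner_scale_left cinner_scale_right g by simp
  then have yy: "cinner (2 * n) y (?G y) = 1" using c by simp
  have uy: "cinner (2 * n) (u i) (?G y) = 0" "cinner (2 * n) y (?G (u i)) = 0" if "i < m" for i
  proof -
    have "cinner (2 * n) (?G (u i)) y = 0"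
      using w(1) that by (simp add: S_def y_def cinner_scale_right)
    then show "cinner (2 * n) (u i) (?G y) = 0" by (simp only: krein_op_hermitian)
    show "cinner (2 * n) y (?G (u i)) = 0"
      by (rule cinner_eq_0_commute[THEN iffD1]) fact
  qed
  have "krein_eigenbasis n A (Suc m) (d(m := e)) (u(m := y))"
    using basis yN yA yy uy w(2) by (auto simp: krein_eigenbasis_def less_Suc_eq)
  then show ?thesis by blast
qed

lemma exists_krein_eigenbasis:
  assumes "A \<in> pos_def_mats (2 * n)" "m \<le> n"
  shows "\<exists>d u. krein_eigenbasis n A m d u"
  using assms(2)
proof (induction m)
  case 0
  show ?case by (simp add: krein_eigenbasis_def)
next
  case (Suc m)
  then obtain d u where "krein_eigenbasis n A m d u" by auto
  with Suc.prems show ?case using krein_eigenbasis_extend[OF assms(1)] by auto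
qed

section \<open>Existence of the Williamson form\<close>

text \<open>The conjugate of u i belongs to - d i, which differs from d j as both d i and d j are
  positive; eigenvectors of a Hermitian pencil for distinct real eigenvalues are orthogonal.\<close>

lemma krein_eigenbasis_conj_orthogonal:
  assumes A: "A \<in> carrier_mat (2 * n) (2 * n)" "transpose_mat A = A"
    and basis: "krein_eigenbasis n A m d u" "i < m" "j < m"
  shows "cinner (2 * n) (conj_fun (u i)) (krein_op n (u j)) = 0"
proof -
  let ?A = "mat_op (2 * n) A" and ?G = "krein_op n"
  define h where "h = cinner (2 * n) (conj_fun (u i)) (?G (u j))"
  have d: "0 < d i" "0 < d j" and eig: "?A (u i) = (\<lambda>r. of_real (d i) * ?G (u i) r)"
    "?A (u j) = (\<lambda>r. of_real (d j) * ?G (u j) r)"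
    using basis by (simp_all add: krein_eigenbasis_def)
  have "of_real (d j) * h = cinner (2 * n) (conj_fun (u i)) (?A (u j))"
    unfolding eig cinner_scale_right h_def ..
  also have "\<dots> = cinner (2 * n) (?A (conj_fun (u i))) (u j)"
    by (rule mat_op_hermitian[OF A, symmetric])
  also have "?A (conj_fun (u i)) = (\<lambda>r. of_real (- d i) * ?G (conj_fun (u i)) r)"
    unfolding mat_op_conj eig krein_op_conj by (simp add: conj_fun_def)
  also have "cinner (2 * n) \<dots> (u j) = of_real (- d i) * h"
    unfolding cinner_scale_left h_def krein_op_hermitian by simp
  finally have "of_real (d j + d i) * h = 0" by (simp add: distrib_right)
  then show ?thesis using d by (simp add: h_def flip: of_real_add)
qed

text \<open>The columns \<open>\<surd>2 Im u\<^sub>j\<close>, \<open>\<surd>2 Re u\<^sub>j\<close> form a symplectic basis because the \<open>u\<^sub>j\<close> and their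
  conjugates are orthonormal for \<open>\<i> J\<close>.\<close>

definition eigenbasis_mat :: "nat \<Rightarrow> (nat \<Rightarrow> nat \<Rightarrow> complex) \<Rightarrow> real mat" where
  "eigenbasis_mat n u =
     mat (2 * n) (2 * n) (\<lambda>(r, c). sqrt 2 * (if c < n then Im (u c r) else Re (u (c - n) r)))"

lemma congruence_index:
  fixes X :: "real mat"
  assumes "M \<in> carrier_mat m m" "X \<in> carrier_mat m m" "i < m" "j < m"
  shows "(transpose_mat M * X * M) $$ (i, j) = col M i \<bullet> (X *\<^sub>v col M j)"
proof -
  have "transpose_mat M * X * M = transpose_mat M * (X * M)"
    by (rule assoc_mult_mat[of _ m m _ m _ m]) (use assms in auto)
  then have "(transpose_mat M * X * M) $$ (i, j) = row (transpose_mat M) i \<bullet> col (X * M) j"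
    using assms by simp
  also have "row (transpose_mat M) i = col M i" using assms by simp
  also have "col (X * M) j = X *\<^sub>v col M j" by (rule col_mult2[OF assms(2,1,4)])
  finally show ?thesis .
qed

definition symp_form :: "nat \<Rightarrow> (nat \<Rightarrow> real) \<Rightarrow> (nat \<Rightarrow> real) \<Rightarrow> real" where
  "symp_form n f g = (\<Sum>l<n. f l * g (n + l) - f (n + l) * g l)"

lemma Re_cinner_krein_op:
  "Re (cinner (2 * n) x (krein_op n y)) =
     symp_form n (\<lambda>r. Im (x r)) (\<lambda>r. Re (y r)) - symp_form n (\<lambda>r. Re (x r)) (\<lambda>r. Im (y r))"
  unfolding cinner_krein_op symp_form_def sum_subtractf[symmetric] Re_sum
  by (rule sum.cong) (simp_all add: algebra_simps)

lemma Im_cinner_krein_op: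
  "Im (cinner (2 * n) x (krein_op n y)) =
     symp_form n (\<lambda>r. Re (x r)) (\<lambda>r. Re (y r)) + symp_form n (\<lambda>r. Im (x r)) (\<lambda>r. Im (y r))"
  unfolding cinner_krein_op symp_form_def sum.distrib[symmetric] Im_sum
  by (rule sum.cong) (simp_all add: algebra_simps)

lemma symp_form_uminus_left: "symp_form n (\<lambda>r. - f r) g = - symp_form n f g"
  by (simp add: symp_form_def sum_negf[symmetric])

text \<open>Real and imaginary parts of the relations of u j with u i and with its conjugate are
  four linear equations for these four products. The 1/2 explains the factor \<open>sqrt 2\<close>
  in \<open>eigenbasis_mat\<close>.\<close>

lemma symp_form_basis:
  assumes A: "A \<in> carrier_mat (2 * n) (2 * n)" "transpose_mat A = A"
    and basis: "krein_eigenbasis n A m d u" "i < m" "j < m"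
  defines "p \<equiv> \<lambda>i r. Re (u i r)" and "q \<equiv> \<lambda>i r. Im (u i r)"
  shows "symp_form n (p i) (p j) = 0" "symp_form n (q i) (q j) = 0"
    "symp_form n (q i) (p j) = (if i = j then 1 / 2 else 0)"
    "symp_form n (p i) (q j) = (if i = j then - 1 / 2 else 0)"
proof -
  have 1: "cinner (2 * n) (u i) (krein_op n (u j)) = (if i = j then 1 else 0)"
    using basis by (simp add: krein_eigenbasis_def)
  have 2: "cinner (2 * n) (conj_fun (u i)) (krein_op n (u j)) = 0"
    by (rule krein_eigenbasis_conj_orthogonal[OF A basis])
  have "symp_form n (q i) (p j) - symp_form n (p i) (q j) = (if i = j then 1 else 0)"
    using arg_cong[OF 1, of Re] unfolding Re_cinner_krein_op p_def q_def by simp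
  moreover have "symp_form n (p i) (p j) + symp_form n (q i) (q j) = 0"
    using arg_cong[OF 1, of Im] unfolding Im_cinner_krein_op p_def q_def by simp
  moreover have "- symp_form n (q i) (p j) - symp_form n (p i) (q j) = 0"
    using arg_cong[OF 2, of Re] unfolding Re_cinner_krein_op p_def q_def
    by (simp add: conj_fun_def symp_form_uminus_left)
  moreover have "symp_form n (p i) (p j) - symp_form n (q i) (q j) = 0"
    using arg_cong[OF 2, of Im] unfolding Im_cinner_krein_op p_def q_def
    by (simp add: conj_fun_def symp_form_uminus_left)
  ultimately show "symp_form n (p i) (p j) = 0" "symp_form n (q i) (q j) = 0"
    "symp_form n (q i) (p j) = (if i = j then 1 / 2 else 0)"
    "symp_form n (p i) (q j) = (if i = j then - 1 / 2 else 0)"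
    by (auto split: if_splits)
qed

lemma eigenbasis_mat_carrier [simp]: "eigenbasis_mat n u \<in> carrier_mat (2 * n) (2 * n)"
  by (simp add: eigenbasis_mat_def)

lemma eigenbasis_mat_col:
  assumes "c < 2 * n"
  shows "col (eigenbasis_mat n u) c \<in> carrier_vec (2 * n)"
    and "r < 2 * n \<Longrightarrow> col (eigenbasis_mat n u) c $ r =
      sqrt 2 * (if c < n then Im (u c r) else Re (u (c - n) r))"
  using assms by (simp_all add: eigenbasis_mat_def carrier_vecI)

lemma eigenbasis_mat_symplectic:
  assumes A: "A \<in> carrier_mat (2 * n) (2 * n)" "transpose_mat A = A"
    and basis: "krein_eigenbasis n A n d u"
  shows "symplectic n (eigenbasis_mat n u)"
proof -
  let ?M = "eigenbasis_mat n u"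
  note sf = symp_form_basis[OF A basis]
  have "transpose_mat ?M * symplectic_J n * ?M = symplectic_J n"
  proof (rule eq_matI)
    fix i j assume "i < dim_row (symplectic_J n)" "j < dim_col (symplectic_J n)"
    then have ij: "i < 2 * n" "j < 2 * n"
      unfolding carrier_matD[OF symplectic_J_carrier] by auto
    have sqrt2: "sqrt 2 * a * (sqrt 2 * b) = 2 * (a * b)" for a b :: real
    proof -
      have "sqrt 2 * a * (sqrt 2 * b) = (sqrt 2 * sqrt 2) * (a * b)" by (simp only: mult_ac)
      then show ?thesis by simp
    qed
    define f where "f = (\<lambda>c r. if c < n then Im (u c r) else Re (u (c - n) r))"
    have "(transpose_mat ?M * symplectic_J n * ?M) $$ (i, j) =
        col ?M i \<bullet> (symplectic_J n *\<^sub>v col ?M j)"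
      by (rule congruence_index[OF eigenbasis_mat_carrier symplectic_J_carrier ij])
    also have "\<dots> = (\<Sum>l<n. 2 * (f i l * f j (n + l) - f i (n + l) * f j l))"
      unfolding scalar_prod_symplectic_J[OF eigenbasis_mat_col(1)[OF ij(1)] eigenbasis_mat_col(1)[OF ij(2)]]
    proof (rule sum.cong)
      fix l assume "l \<in> {..<n}"
      then have "l < 2 * n" "n + l < 2 * n" by auto
      show "col ?M i $ l * col ?M j $ (n + l) - col ?M i $ (n + l) * col ?M j $ l =
          2 * (f i l * f j (n + l) - f i (n + l) * f j l)"
        unfolding eigenbasis_mat_col(2)[OF ij(1) \<open>l < 2 * n\<close>] eigenbasis_mat_col(2)[OF ij(2) \<open>l < 2 * n\<close>]
          eigenbasis_mat_col(2)[OF ij(1) \<open>n + l < 2 * n\<close>] eigenbasis_mat_col(2)[OF ij(2) \<open>n + l < 2 * n\<close>]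
        unfolding f_def sqrt2 right_diff_distrib ..
    qed simp
    also have "\<dots> = 2 * symp_form n (f i) (f j)"
      unfolding symp_form_def by (rule sum_distrib_left[symmetric])
    also have "\<dots> = symplectic_J n $$ (i, j)"
    proof -
      have lo: "f c = (\<lambda>r. Im (u c r))" if "c < n" for c using that by (simp add: f_def)
      have hi: "f c = (\<lambda>r. Re (u (c - n) r))" "c - n < n" if "\<not> c < n" "c < 2 * n" for c
        using that by (simp_all add: f_def)
      show ?thesis
        unfolding symplectic_J_index[OF ij]
      \<comment> \<open>One case for each block of J. Imaginary parts come first among the columns
        so that the upper right block is +1.\<close>
      proof (cases "i < n"; cases "j < n")
        assume "i < n" "j < n"
        then show "2 * symp_form n (f i) (f j) = (if j = i + n then 1 else if i = j + n then - 1 else 0)"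
          using sf(2)[of i j] by (simp add: lo)
      next
        assume "i < n" "\<not> j < n"
        then show "2 * symp_form n (f i) (f j) = (if j = i + n then 1 else if i = j + n then - 1 else 0)"
          using sf(3)[of i "j - n"] hi[of j] ij by (auto simp: lo)
      next
        assume "\<not> i < n" "j < n"
        then show "2 * symp_form n (f i) (f j) = (if j = i + n then 1 else if i = j + n then - 1 else 0)"
          using sf(4)[of "i - n" j] hi[of i] ij by (auto simp: lo)
      next
        assume "\<not> i < n" "\<not> j < n"
        then show "2 * symp_form n (f i) (f j) = (if j = i + n then 1 else if i = j + n then - 1 else 0)"
          using sf(1)[of "i - n" "j - n"] hi[of i] hi[of j] ij by auto
      qed
    qed
    finally show "(transpose_mat ?M * symplectic_J n * ?M) $$ (i, j) = symplectic_J n $$ (i, j)" .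
  qed (simp_all add: carrier_matD[OF symplectic_J_carrier] carrier_matD[OF eigenbasis_mat_carrier])
  then show ?thesis unfolding symplectic_def by (intro conjI eigenbasis_mat_carrier)
qed

text \<open>For u = p + \<i> q the imaginary and real parts of A u = d (\<i> J) u read A q = d J p
  and A p = - d J q.\<close>

lemma eigenbasis_mat_image:
  assumes A: "A \<in> carrier_mat (2 * n) (2 * n)"
    and basis: "krein_eigenbasis n A n d u" and "j < n"
  shows "A *\<^sub>v col (eigenbasis_mat n u) j = d j \<cdot>\<^sub>v (symplectic_J n *\<^sub>v col (eigenbasis_mat n u) (n + j))"
    and "A *\<^sub>v col (eigenbasis_mat n u) (n + j) = - d j \<cdot>\<^sub>v (symplectic_J n *\<^sub>v col (eigenbasis_mat n u) j)"
proof -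
  let ?M = "eigenbasis_mat n u"
  have jn: "j < 2 * n" "n + j < 2 * n" using \<open>j < n\<close> by auto
  note cm = eigenbasis_mat_col(1)[OF jn(1), of u] eigenbasis_mat_col(1)[OF jn(2), of u]
  have eig: "(\<Sum>s<2 * n. of_real (A $$ (r, s)) * u j s) = of_real (d j) * krein_op n (u j) r"
    if "r < 2 * n" for r
  proof -
    have "mat_op (2 * n) A (u j) = (\<lambda>r. of_real (d j) * krein_op n (u j) r)"
      using basis \<open>j < n\<close> by (simp add: krein_eigenbasis_def)
    from fun_cong[OF this, of r] that show ?thesis by (simp add: mat_op_def)
  qed
  have A_mult: "(A *\<^sub>v v) $ r = (\<Sum>s<2 * n. A $$ (r, s) * v $ s)"
    if "r < 2 * n" "v \<in> carrier_vec (2 * n)" for v r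
    using A that by (simp add: scalar_prod_def atLeast0LessThan)
  have re: "(A *\<^sub>v col ?M (n + j)) $ r = sqrt 2 * (d j * Re (krein_op n (u j) r))"
    and im: "(A *\<^sub>v col ?M j) $ r = sqrt 2 * (d j * Im (krein_op n (u j) r))" if r: "r < 2 * n" for r
  proof -
    have "(A *\<^sub>v col ?M (n + j)) $ r = sqrt 2 * (\<Sum>s<2 * n. A $$ (r, s) * Re (u j s))"
      unfolding A_mult[OF r cm(2)] sum_distrib_left
      by (rule sum.cong) (simp_all add: eigenbasis_mat_col(2)[OF jn(2)])
    also have "(\<Sum>s<2 * n. A $$ (r, s) * Re (u j s)) = d j * Re (krein_op n (u j) r)"
      using arg_cong[OF eig[OF r], of Re] by simp
    finally show "(A *\<^sub>v col ?M (n + j)) $ r = sqrt 2 * (d j * Re (krein_op n (u j) r))" .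
    have "(A *\<^sub>v col ?M j) $ r = sqrt 2 * (\<Sum>s<2 * n. A $$ (r, s) * Im (u j s))"
      unfolding A_mult[OF r cm(1)] sum_distrib_left
      by (rule sum.cong) (simp_all add: eigenbasis_mat_col(2)[OF jn(1)] \<open>j < n\<close>)
    also have "(\<Sum>s<2 * n. A $$ (r, s) * Im (u j s)) = d j * Im (krein_op n (u j) r)"
      using arg_cong[OF eig[OF r], of Im] by simp
    finally show "(A *\<^sub>v col ?M j) $ r = sqrt 2 * (d j * Im (krein_op n (u j) r))" .
  qed
  have dims: "dim_row A = 2 * n" "dim_row (symplectic_J n) = 2 * n"
    using A carrier_matD[OF symplectic_J_carrier[of n]] by auto
  show "A *\<^sub>v col ?M j = d j \<cdot>\<^sub>v (symplectic_J n *\<^sub>v col ?M (n + j))"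
  proof (rule eq_vecI)
    fix r assume "r < dim_vec (d j \<cdot>\<^sub>v (symplectic_J n *\<^sub>v col ?M (n + j)))"
    then have r: "r < 2 * n" by (simp add: dims)
    then have "(d j \<cdot>\<^sub>v (symplectic_J n *\<^sub>v col ?M (n + j))) $ r =
        d j * (symplectic_J n *\<^sub>v col ?M (n + j)) $ r" by (simp add: dims)
    also have "\<dots> = sqrt 2 * (d j * Im (krein_op n (u j) r))"
      unfolding symplectic_J_mult_vec[OF cm(2) r]
      using r \<open>j < n\<close> by (simp add: eigenbasis_mat_col(2)[OF jn(2)] krein_op_def)
    finally show "(A *\<^sub>v col ?M j) $ r = (d j \<cdot>\<^sub>v (symplectic_J n *\<^sub>v col ?M (n + j))) $ r"
      using im[OF r] by simp
  qed (simp add: dims)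
  show "A *\<^sub>v col ?M (n + j) = - d j \<cdot>\<^sub>v (symplectic_J n *\<^sub>v col ?M j)"
  proof (rule eq_vecI)
    fix r assume "r < dim_vec (- d j \<cdot>\<^sub>v (symplectic_J n *\<^sub>v col ?M j))"
    then have r: "r < 2 * n" by (simp add: dims)
    then have "(- d j \<cdot>\<^sub>v (symplectic_J n *\<^sub>v col ?M j)) $ r =
        - d j * (symplectic_J n *\<^sub>v col ?M j) $ r" by (simp add: dims)
    also have "\<dots> = sqrt 2 * (d j * Re (krein_op n (u j) r))"
      unfolding symplectic_J_mult_vec[OF cm(1) r]
      using r \<open>j < n\<close> by (simp add: eigenbasis_mat_col(2)[OF jn(1)] krein_op_def)
    finally show "(A *\<^sub>v col ?M (n + j)) $ r = (- d j \<cdot>\<^sub>v (symplectic_J n *\<^sub>v col ?M j)) $ r"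
      using re[OF r] by simp
  qed (simp add: dims)
qed

text \<open>The columns of A M are multiples of columns of J M, so the entries can be read off from
  M^T J M = J.\<close>

lemma eigenbasis_mat_diagonalizes:
  assumes A: "A \<in> carrier_mat (2 * n) (2 * n)" "transpose_mat A = A"
    and basis: "krein_eigenbasis n A n d u"
  shows "transpose_mat (eigenbasis_mat n u) * A * eigenbasis_mat n u = double_diag n d"
proof (rule eq_matI)
  let ?M = "eigenbasis_mat n u"
  fix i j assume "i < dim_row (double_diag n d)" "j < dim_col (double_diag n d)"
  then have ij: "i < 2 * n" "j < 2 * n"
    unfolding carrier_matD[OF double_diag_carrier] by auto
  have J: "col ?M i \<bullet> (symplectic_J n *\<^sub>v col ?M c) = symplectic_J n $$ (i, c)" if "c < 2 * n" for c
    using congruence_index[OF eigenbasis_mat_carrier symplectic_J_carrier ij(1) that, of u]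
      eigenbasis_mat_symplectic[OF A basis] by (simp add: symplectic_def)
  have smult: "col ?M i \<bullet> (e \<cdot>\<^sub>v (symplectic_J n *\<^sub>v col ?M c)) = e * symplectic_J n $$ (i, c)"
    if "c < 2 * n" for c e
    unfolding J[OF that, symmetric]
    by (rule scalar_prod_smult_distrib[OF eigenbasis_mat_col(1)[OF ij(1)]
          mult_mat_vec_carrier[OF symplectic_J_carrier eigenbasis_mat_col(1)[OF that]]])
  have "(transpose_mat ?M * A * ?M) $$ (i, j) = col ?M i \<bullet> (A *\<^sub>v col ?M j)"
    by (rule congruence_index[OF eigenbasis_mat_carrier A(1) ij])
  also have "\<dots> = double_diag n d $$ (i, j)"
  proof (cases "j < n")
    case True
    then have "n + j < 2 * n" by simp
    show ?thesis
      unfolding eigenbasis_mat_image(1)[OF A(1) basis True] smult[OF \<open>n + j < 2 * n\<close>]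
        symplectic_J_index[OF ij(1) \<open>n + j < 2 * n\<close>] double_diag_index[OF ij]
      using True ij by auto
  next
    case False
    then have j: "j - n < n" "j - n < 2 * n" "n + (j - n) = j" using ij by auto
    show ?thesis
      using eigenbasis_mat_image(2)[OF A(1) basis j(1)]
      unfolding j(3) double_diag_index[OF ij]
      using smult[OF j(2), of "- d (j - n)"] symplectic_J_index[OF ij(1) j(2)] False ij by auto
  qed
  finally show "(transpose_mat ?M * A * ?M) $$ (i, j) = double_diag n d $$ (i, j)" .
qed (simp_all add: carrier_matD[OF double_diag_carrier] carrier_matD[OF eigenbasis_mat_carrier])

theorem williamson:
  assumes "A \<in> pos_def_mats (2 * n)"
  obtains ds where "williamson_form n A ds"
proof -
  have A: "A \<in> carrier_mat (2 * n) (2 * n)" "transpose_mat A = A"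
    using assms by (auto simp: pos_def_mats_def)
  obtain d u where basis: "krein_eigenbasis n A n d u"
    using exists_krein_eigenbasis[OF assms order_refl] by blast
  \<comment> \<open>The eigenvalues come in the order in which they were split off. One permutation
    sorts them and moves the eigenvectors along, which preserves orthonormality.\<close>
  define idx where "idx = sort_key d [0..<n]"
  have idx: "length idx = n" "distinct idx" "set idx = {..<n}" by (auto simp: idx_def)
  then have less: "idx ! j < n" if "j < n" for j using nth_mem[of j idx] \<open>j < n\<close> by auto
  define ds where "ds = map d idx"
  have nth: "ds ! i = d (idx ! i)" if "i < n" for i using that idx by (simp add: ds_def)
  have "sorted ds" unfolding ds_def idx_def by (rule sorted_sort_key)
  have basis': "krein_eigenbasis n A n (\<lambda>j. ds ! j) (\<lambda>j. u (idx ! j))"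
    using basis less idx nth_eq_iff_index_eq[OF idx(2)]
    by (simp add: krein_eigenbasis_def nth)
  have "\<forall>e\<in>set ds. 0 < e" using basis idx(3) by (auto simp: ds_def krein_eigenbasis_def)
  moreover have "length ds = n" by (simp add: ds_def idx(1))
  ultimately have "williamson_form n A ds"
    using \<open>sorted ds\<close> eigenbasis_mat_symplectic[OF A basis'] eigenbasis_mat_diagonalizes[OF A basis']
    unfolding williamson_form_def double_diag_def by blast
  then show ?thesis by (rule that)
qed

lemma symplectic_eigenvalues_williamson:
  assumes "A \<in> pos_def_mats (2 * n)"
  shows "williamson_form n A (symplectic_eigenvalues n A)"
proof -
  have "A \<in> carrier_mat (2 * n) (2 * n)" using assms by (simp add: pos_def_mats_def)
  moreover obtain ds where "williamson_form n A ds" by (rule williamson[OF assms])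
  ultimately show ?thesis using symplectic_eigenvalues_eq by simp
qed

section \<open>The inequality for symplectic eigenvalues\<close>

lemma pos_def_mats_add:
  assumes "A \<in> pos_def_mats m" "B \<in> pos_def_mats m"
  shows "A + B \<in> pos_def_mats m"
proof -
  have c: "A \<in> carrier_mat m m" "B \<in> carrier_mat m m" "transpose_mat A = A" "transpose_mat B = B"
    using assms by (auto simp: pos_def_mats_def)
  have "x \<bullet> ((A + B) *\<^sub>v x) > 0" if x: "x \<in> carrier_vec m" "x \<noteq> 0\<^sub>v m" for x
  proof -
    have "x \<bullet> ((A + B) *\<^sub>v x) = x \<bullet> (A *\<^sub>v x) + x \<bullet> (B *\<^sub>v x)"
      using c x by (simp add: add_mult_distrib_mat_vec[of _ m m] scalar_prod_add_distrib[of _ m])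
    also have "\<dots> > 0" using assms x by (auto simp: pos_def_mats_def intro: add_pos_pos)
    finally show ?thesis .
  qed
  then show ?thesis using c by (simp add: pos_def_mats_def transpose_add[of _ m m])
qed

lemma pos_def_mats_one: "1\<^sub>m m \<in> pos_def_mats m"
proof -
  have "x \<bullet> x > 0" if x: "x \<in> carrier_vec m" "x \<noteq> 0\<^sub>v m" for x :: "real vec"
  proof -
    have "\<exists>i<m. x $ i \<noteq> 0"
    proof (rule ccontr)
      assume "\<not> ?thesis"
      then have "x = 0\<^sub>v m" using x(1) by (intro eq_vecI) auto
      with x(2) show False by simp
    qed
    then obtain i where i: "i < m" "x $ i \<noteq> 0" by blast
    have "0 < (\<Sum>l<m. x $ l * x $ l)"
      by (rule sum_pos2[of _ i]) (use i in \<open>auto simp: zero_less_mult_iff linorder_neq_iff\<close>)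
    then show ?thesis using x(1) by (simp add: scalar_prod_def atLeast0LessThan)
  qed
  then show ?thesis by (simp add: pos_def_mats_def)
qed

lemma lidskii_symplectic:
  assumes "A \<in> pos_def_mats (2 * n)" "B \<in> pos_def_mats (2 * n)"
    and "is": "sorted_wrt (<) is" "\<forall>i\<in>set is. i < n"
  shows "(\<Sum>i\<leftarrow>is. symplectic_eigenvalues n A ! i) + (\<Sum>j<length is. symplectic_eigenvalues n B ! j)
    \<le> (\<Sum>i\<leftarrow>is. symplectic_eigenvalues n (A + B) ! i)"
proof -
  have c: "A \<in> carrier_mat (2 * n) (2 * n)" "B \<in> carrier_mat (2 * n) (2 * n)"
    using assms by (auto simp: pos_def_mats_def)
  obtain N where N: "symplectic n N"
    "transpose_mat N * A * N = double_diag n (\<lambda>i. symplectic_eigenvalues n A ! i)"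
    "length (symplectic_eigenvalues n A) = n"
    "mono_on {..<n} (\<lambda>i. symplectic_eigenvalues n A ! i)" "\<forall>l<n. 0 < symplectic_eigenvalues n A ! l"
    by (rule williamson_formE[OF symplectic_eigenvalues_williamson[OF assms(1)]])
  obtain N' where N': "symplectic n N'"
    "transpose_mat N' * B * N' = double_diag n (\<lambda>i. symplectic_eigenvalues n B ! i)"
    "length (symplectic_eigenvalues n B) = n"
    "mono_on {..<n} (\<lambda>i. symplectic_eigenvalues n B ! i)" "\<forall>l<n. 0 < symplectic_eigenvalues n B ! l"
    by (rule williamson_formE[OF symplectic_eigenvalues_williamson[OF assms(2)]])
  obtain M where M: "symplectic n M"
    "transpose_mat M * (A + B) * M = double_diag n (\<lambda>i. symplectic_eigenvalues n (A + B) ! i)"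
    "length (symplectic_eigenvalues n (A + B)) = n"
    "mono_on {..<n} (\<lambda>i. symplectic_eigenvalues n (A + B) ! i)"
    "\<forall>l<n. 0 < symplectic_eigenvalues n (A + B) ! l"
    by (rule williamson_formE[OF symplectic_eigenvalues_williamson[OF pos_def_mats_add[OF assms(1,2)]]])
  show ?thesis
    by (rule lidskii_matrices[OF c N(1,2) N'(1,2) M(1,2) N(4) _ N'(4) _ M(4) "is"])
      (use N(5) N'(5) in \<open>auto simp: less_imp_le\<close>)
qed

theorem corollary5p6:
  fixes n :: nat and A B :: "real mat"
  assumes "A \<in> pos_def_mats (2 * n)" and "B \<in> pos_def_mats (2 * n)"
  shows "(\<forall>k \<in> {1..n}. \<forall>i :: nat \<Rightarrow> nat.
            strict_mono_on {1..k} i \<and> i ` {1..k} \<subseteq> {1..n} \<longrightarrow>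
            (\<Sum>j = 1..k. symplectic_eigenvalue n (A + B) (i j))
              \<ge> (\<Sum>j = 1..k. symplectic_eigenvalue n A (i j))
                + (\<Sum>j = 1..k. symplectic_eigenvalue n B j)) \<and>
         (\<forall>j \<in> {1..n}.
            symplectic_eigenvalue n (A + B) j
              \<ge> symplectic_eigenvalue n A j + symplectic_eigenvalue n B 1 \<and>
            symplectic_eigenvalue n (A + 1\<^sub>m (2 * n)) j
              \<ge> symplectic_eigenvalue n A j + 1)"
proof (intro conjI ballI allI impI)
  fix k and i :: "nat \<Rightarrow> nat"
  assume k: "k \<in> {1..n}" and i: "strict_mono_on {1..k} i \<and> i ` {1..k} \<subseteq> {1..n}"
  \<comment> \<open>The chosen indices as a list counted from 0: both the position and the index
    itself are lowered by one.\<close>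
  define js where "js = map (\<lambda>j. i (Suc j) - 1) [0..<k]"
  have range: "1 \<le> i (Suc j)" "i (Suc j) \<le> n" if "j < k" for j
  proof -
    have "Suc j \<in> {1..k}" using that by simp
    then have "i (Suc j) \<in> {1..n}" using i by blast
    then show "1 \<le> i (Suc j)" "i (Suc j) \<le> n" by auto
  qed
  have "sorted_wrt (<) js"
    unfolding js_def sorted_wrt_map
  proof (rule sorted_wrt_mono_rel[OF _ sorted_wrt_upt])
    fix x y assume "x \<in> set [0..<k]" "y \<in> set [0..<k]" "x < y"
    \<comment> \<open>The lower bound 1 keeps the truncated subtraction strictly increasing.\<close>
    then have "i (Suc x) < i (Suc y)" "1 \<le> i (Suc x)"
      using i range by (auto simp: strict_mono_on_def)
    then show "i (Suc x) - 1 < i (Suc y) - 1" by simp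
  qed
  moreover have "\<forall>l\<in>set js. l < n" using range by (fastforce simp: js_def)
  ultimately have "(\<Sum>l\<leftarrow>js. symplectic_eigenvalues n A ! l) + (\<Sum>j<length js. symplectic_eigenvalues n B ! j)
    \<le> (\<Sum>l\<leftarrow>js. symplectic_eigenvalues n (A + B) ! l)"
    by (rule lidskii_symplectic[OF assms])
  moreover have "(\<Sum>l\<leftarrow>js. symplectic_eigenvalues n X ! l) = (\<Sum>j = 1..k. symplectic_eigenvalue n X (i j))" for X
    by (simp add: js_def o_def interv_sum_list_conv_sum_set_nat symplectic_eigenvalue_def
        sum.atLeast1_atMost_eq atLeast0LessThan)
  moreover have "(\<Sum>j<length js. symplectic_eigenvalues n B ! j) = (\<Sum>j = 1..k. symplectic_eigenvalue n B j)"
    by (simp add: js_def symplectic_eigenvalue_def sum.atLeast1_atMost_eq)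
  ultimately show "(\<Sum>j = 1..k. symplectic_eigenvalue n (A + B) (i j))
      \<ge> (\<Sum>j = 1..k. symplectic_eigenvalue n A (i j)) + (\<Sum>j = 1..k. symplectic_eigenvalue n B j)"
    by simp
next
  fix j assume j: "j \<in> {1..n}"
  have single: "symplectic_eigenvalue n A j + symplectic_eigenvalue n X 1 \<le> symplectic_eigenvalue n (A + X) j"
    if "X \<in> pos_def_mats (2 * n)" for X
    using lidskii_symplectic[OF assms(1) that, of "[j - 1]"] j by (auto simp: symplectic_eigenvalue_def)
  show "symplectic_eigenvalue n (A + B) j \<ge> symplectic_eigenvalue n A j + symplectic_eigenvalue n B 1"
    by (rule single[OF assms(2)])
  have "symplectic_eigenvalues n (1\<^sub>m (2 * n)) = replicate n 1"
    by (rule symplectic_eigenvalues_eq[OF one_carrier_mat williamson_form_one])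
  \<comment> \<open>That j lies in {1..n} forces n \<ge> 1, so the list of ones has a first
    entry.\<close>
  then have "symplectic_eigenvalue n (1\<^sub>m (2 * n)) 1 = 1" using j by (simp add: symplectic_eigenvalue_def)
  then show "symplectic_eigenvalue n (A + 1\<^sub>m (2 * n)) j \<ge> symplectic_eigenvalue n A j + 1"
    using single[OF pos_def_mats_one] by simp
qed

end
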